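(* Let $k\ge 1$, $\delta_1,\dots,\delta_k>0$ and $-\infty<b_1<\dots<b_k<\infty$, and, if $X$ has paths of bounded variation, assume $\delta_1+\dots+\delta_k<c$. Then there exists a strong solution $U_k$ to the stochastic differential equation $$dU_k(t)=dX(t)-\sum_{i=1}^k\delta_i\mathbf 1_{\{U_k(t)>b_i\}}\,dt .$$
   Context: $X=\{X(t),t\ge0\}$ is a spectrally negative Lévy process (no positive jumps) on a filtered probability space, not having monotone paths, with an arbitrary starting point $X(0)=x\in\mathbb R$. Its Laplace exponent is $\psi(\lambda)=\gamma\lambda+\frac12\sigma^2\lambda^2+\int_0^\infty(e^{-\lambda z}-1+\lambda z\mathbf 1_{(0,1)}(z))\,\Pi(dz)$, $\lambda\ge 0$, where $\gamma\in\mathbb R$, $\sigma\ge0$ and $\int_0^\infty(1\wedge z^2)\,\Pi(dz)<\infty$ (so $\mathbb E_0[e^{\lambda X(t)}]=e^{t\psi(\lambda)}$). $X$ has paths of bounded variation iff $\sigma=0$ and $\int_0^1 z\,\Pi(dz)<\infty$; in that case its drift is $c:=\gamma+\int_0^1z\,\Pi(dz)$. The SDE is understood in integral form, $U_k(t)=X(t)-\sum_{i=1}^k\delta_i\int_0^t\mathbf 1_{\{U_k(s)>b_i\}}\,ds$ for all $t\ge 0$ (so $U_k(0)=X(0)$); a strong solution is a process adapted to the filtration of $X$ satisfying this almost surely. *)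

theory Defs
  imports "HOL-Probability.Probability"
begin

text \<open>Time is \<open>real\<close>; values at negative times are irrelevant throughout.\<close>

definition cadlag :: "(real \<Rightarrow> real) \<Rightarrow> bool" where
  "cadlag f \<longleftrightarrow>
     (\<forall>t\<ge>0. continuous (at_right t) f) \<and> (\<forall>t>0. \<exists>l. (f \<longlongrightarrow> l) (at_left t))"

definition no_positive_jumps :: "(real \<Rightarrow> real) \<Rightarrow> bool" where
  "no_positive_jumps f \<longleftrightarrow> (\<forall>t>0. \<forall>l. (f \<longlongrightarrow> l) (at_left t) \<longrightarrow> f t \<le> l)"

definition bounded_variation_on :: "real set \<Rightarrow> (real \<Rightarrow> real) \<Rightarrow> bool" where
  "bounded_variation_on S f \<longleftrightarrow>
     (\<exists>B. \<forall>ts. sorted ts \<and> set ts \<subseteq> S \<longrightarrow>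
        (\<Sum>i<length ts - 1. \<bar>f (ts ! Suc i) - f (ts ! i)\<bar>) \<le> B)"

locale filtered_prob_space = prob_space M
  for M :: "'a measure" +
  fixes F :: "real \<Rightarrow> 'a measure"
  assumes subalgebra_F: "0 \<le> t \<Longrightarrow> subalgebra M (F t)"
    and sets_F_mono: "0 \<le> s \<Longrightarrow> s \<le> t \<Longrightarrow> sets (F s) \<subseteq> sets (F t)"

locale levy_process = filtered_prob_space M F
  for M :: "'a measure" and F :: "real \<Rightarrow> 'a measure" +
  fixes X :: "real \<Rightarrow> 'a \<Rightarrow> real" and x :: real
  assumes adapted: "0 \<le> t \<Longrightarrow> X t \<in> borel_measurable (F t)"
    and start: "AE \<omega> in M. X 0 \<omega> = x"
    and indep_increments: "0 \<le> s \<Longrightarrow> s \<le> t \<Longrightarrow>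
      indep_set (sets (F s))
        {(\<lambda>\<omega>. X t \<omega> - X s \<omega>) -` A \<inter> space M | A. A \<in> sets borel}"
    and stationary_increments: "0 \<le> s \<Longrightarrow> s \<le> t \<Longrightarrow>
      distr M borel (\<lambda>\<omega>. X t \<omega> - X s \<omega>) =
      distr M borel (\<lambda>\<omega>. X (t - s) \<omega> - X 0 \<omega>)"
    and cadlag_paths: "AE \<omega> in M. cadlag (\<lambda>t. X t \<omega>)"

text \<open>The measure \<open>\<nu>\<close> lives on the sizes \<open>z > 0\<close> of the downward jumps.\<close>

definition levy_measure :: "real measure \<Rightarrow> bool" where
  "levy_measure \<nu> \<longleftrightarrow>
     sets \<nu> = sets borel \<and> emeasure \<nu> {..0} = 0 \<and>
     (\<integral>\<^sup>+ z\<in>{0<..}. ennreal (min 1 (z\<^sup>2)) \<partial>\<nu>) < \<infinity>"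

definition laplace_exponent :: "real \<Rightarrow> real \<Rightarrow> real measure \<Rightarrow> real \<Rightarrow> real" where
  "laplace_exponent \<gamma> \<sigma> \<nu> \<theta> =
     \<gamma> * \<theta> + 1 / 2 * \<sigma>\<^sup>2 * \<theta>\<^sup>2 +
     (LINT z:{0<..}|\<nu>. exp (- \<theta> * z) - 1 + \<theta> * z * indicator {0<..<1} z)"

text \<open>\<open>E\<^sub>0\<close> refers to the law of \<open>X - X 0\<close>, whence the increment in the
  Laplace transform below.\<close>

locale spectrally_negative_levy_process = levy_process M F X x
  for M :: "'a measure" and F :: "real \<Rightarrow> 'a measure"
    and X :: "real \<Rightarrow> 'a \<Rightarrow> real" and x :: real +
  fixes \<gamma> \<sigma> :: real and \<nu> :: "real measure"
  assumes spectrally_negative: "AE \<omega> in M. no_positive_jumps (\<lambda>t. X t \<omega>)"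
    and sigma_nonneg: "0 \<le> \<sigma>"
    and levy_measure: "levy_measure \<nu>"
    and laplace_transform: "0 \<le> t \<Longrightarrow> 0 \<le> \<theta> \<Longrightarrow>
      has_bochner_integral M (\<lambda>\<omega>. exp (\<theta> * (X t \<omega> - X 0 \<omega>)))
        (exp (t * laplace_exponent \<gamma> \<sigma> \<nu> \<theta>))"

definition monotone_paths :: "'a measure \<Rightarrow> (real \<Rightarrow> 'a \<Rightarrow> real) \<Rightarrow> bool" where
  "monotone_paths M X \<longleftrightarrow>
     (AE \<omega> in M. mono_on {0..} (\<lambda>t. X t \<omega>)) \<or>
     (AE \<omega> in M. antimono_on {0..} (\<lambda>t. X t \<omega>))"

definition bounded_variation_paths :: "'a measure \<Rightarrow> (real \<Rightarrow> 'a \<Rightarrow> real) \<Rightarrow> bool" where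
  "bounded_variation_paths M X \<longleftrightarrow>
     (AE \<omega> in M. \<forall>T\<ge>0. bounded_variation_on {0..T} (\<lambda>t. X t \<omega>))"

text \<open>The drift is meaningful only for paths of bounded variation, in which case the integral
  converges; otherwise the Bochner integral may default to \<open>0\<close>.\<close>

definition levy_drift :: "real \<Rightarrow> real measure \<Rightarrow> real" where
  "levy_drift \<gamma> \<nu> = \<gamma> + (LINT z:{0<..<1}|\<nu>. z)"

definition natural_filtration ::
    "'a measure \<Rightarrow> (real \<Rightarrow> 'a \<Rightarrow> real) \<Rightarrow> real \<Rightarrow> 'a measure" where
  "natural_filtration M X t =
     sigma (space M) (\<Union>s\<in>{0..t}. {X s -` A \<inter> space M | A. A \<in> sets borel})"

text \<open>Adaptedness is to the uncompleted natural filtration of \<open>X\<close>, hence also to every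
  filtration to which \<open>X\<close> is adapted.  Integrability is required explicitly because the
  Bochner integral of a non-integrable function is \<open>0\<close>.\<close>

definition strong_solution ::
    "'a measure \<Rightarrow> (real \<Rightarrow> 'a \<Rightarrow> real) \<Rightarrow> nat \<Rightarrow> (nat \<Rightarrow> real) \<Rightarrow> (nat \<Rightarrow> real) \<Rightarrow>
     (real \<Rightarrow> 'a \<Rightarrow> real) \<Rightarrow> bool" where
  "strong_solution M X k \<delta> b U \<longleftrightarrow>
     (\<forall>t\<ge>0. U t \<in> borel_measurable (natural_filtration M X t)) \<and>
     (AE \<omega> in M. \<forall>t\<ge>0.
        (\<forall>i\<in>{1..k}. set_integrable lborel {0..t} (\<lambda>s. indicator {b i<..} (U s \<omega>) :: real)) \<and>
        U t \<omega> = X t \<omega> - (\<Sum>i=1..k. \<delta> i * (LINT s:{0..t}|lborel. indicator {b i<..} (U s \<omega>))))"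

end

theory Submission
  imports Defs
begin

text \<open>
  Put \<open>f u = (\<Sum>i. \<delta> i * indicator {b i<..} u)\<close> and \<open>K = (\<Sum>i. \<delta> i)\<close>, and write \<open>U = X - V\<close> with
  \<open>V' = f (X - V)\<close>.  Because \<open>f\<close> is monotone, the Euler schemes for \<open>V\<close> along any fixed cadlag path
  form a Cauchy sequence: the difference of two schemes is damped, up to the time discretisation
  error of the path.  The schemes read off only grid values of the past, so their limit is adapted
  to the uncompleted natural filtration, and it solves the integral equation as soon as \<open>U\<close> spends
  Lebesgue-null time at each of the levels \<open>b i\<close>, the discontinuities of \<open>f\<close>.

  To see that the latter holds almost surely, note that \<open>U s = U (s + h) = y\<close> forces
  \<open>X (s + h) - X s \<le> K * h\<close>, an event independent of the past.  If its probability is at most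
  \<open>q < 1\<close> along some \<open>h\<close> tending to \<open>0\<close>, then the expected time \<open>p\<close> spent at \<open>y\<close> satisfies
  \<open>p \<le> q * p\<close> in the limit, since by right-continuity paths away from \<open>y\<close> contribute nothing.
  Such \<open>h\<close> exist because \<open>\<psi> \<theta> - K * \<theta>\<close> grows at least linearly: the slope of \<open>\<psi>\<close> at infinity is the
  drift if \<open>\<sigma> = 0\<close> and small jumps are summable, in which case the paths have bounded variation,
  and it is infinite otherwise.
\<close>

section \<open>Euler schemes for additive noise\<close>

text \<open>The scheme discretises the correction \<open>V\<close> in \<open>U = X - V\<close>
  rather than \<open>U\<close>: for bounded \<open>f\<close> its increments are bounded whatever the
  path does. Node \<open>j\<close> reads \<open>X\<close> only at grid times before
  \<open>j * e\<close>, which later gives adaptedness.\<close>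

primrec euler_node :: "(real \<Rightarrow> real) \<Rightarrow> (real \<Rightarrow> real) \<Rightarrow> real \<Rightarrow> nat \<Rightarrow> real" where
  "euler_node f X e 0 = 0"
| "euler_node f X e (Suc j) =
     euler_node f X e j + e * f (X (real j * e) - euler_node f X e j)"

text \<open>The scheme's value of \<open>U\<close> at the left end of cell \<open>j\<close>;
  throughout the cell \<open>f\<close> is frozen there.\<close>

definition euler_arg :: "(real \<Rightarrow> real) \<Rightarrow> (real \<Rightarrow> real) \<Rightarrow> real \<Rightarrow> nat \<Rightarrow> real" where
  "euler_arg f X e j = X (real j * e) - euler_node f X e j"

definition cell :: "real \<Rightarrow> real \<Rightarrow> nat" where
  "cell e t = nat \<lfloor>t / e\<rfloor>"

definition euler :: "(real \<Rightarrow> real) \<Rightarrow> (real \<Rightarrow> real) \<Rightarrow> real \<Rightarrow> real \<Rightarrow> real" where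
  "euler f X e t = euler_node f X e (cell e t) +
     (t - real (cell e t) * e) * f (euler_arg f X e (cell e t))"

lemma cell_bounds:
  assumes "0 < e" "0 \<le> t"
  shows "real (cell e t) * e \<le> t" "t < (real (cell e t) + 1) * e"
proof -
  have *: "real (cell e t) = of_int \<lfloor>t / e\<rfloor>"
    using assms by (simp add: cell_def)
  have "of_int \<lfloor>t / e\<rfloor> \<le> t / e" "t / e < of_int \<lfloor>t / e\<rfloor> + 1"
    by linarith+
  then show "real (cell e t) * e \<le> t" "t < (real (cell e t) + 1) * e"
    unfolding * using assms by (simp_all only: pos_le_divide_eq pos_divide_less_eq)
qed

lemma cell_eq:
  assumes "0 < e" "real j * e \<le> t" "t < (real j + 1) * e"
  shows "cell e t = j"
proof -
  have "\<lfloor>t / e\<rfloor> = int j"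
    using assms by (intro floor_unique) (simp_all add: field_simps)
  then show ?thesis by (simp add: cell_def)
qed

lemma measurable_cell [measurable]: "cell e \<in> measurable borel (count_space UNIV)"
  unfolding cell_def by measurable

lemma euler_node_Suc: "euler_node f X e (Suc j) = euler_node f X e j + e * f (euler_arg f X e j)"
  by (simp add: euler_arg_def)

text \<open>At the right end \<open>cell\<close> has already moved on to \<open>Suc j\<close>, but
  the formulas of the two cells agree there. Having both endpoints lets neighbouring cells be
  glued.\<close>

lemma euler_on_cell:
  assumes "0 < e" "real j * e \<le> t" "t \<le> (real j + 1) * e"
  shows "euler f X e t = euler_node f X e j + (t - real j * e) * f (euler_arg f X e j)"
proof (cases "t = (real j + 1) * e")
  case True
  have "cell e t = Suc j"
    using assms by (intro cell_eq) (simp_all add: True field_simps)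
  then show ?thesis
    using assms(1) by (simp add: euler_def True euler_node_Suc ring_distribs del: euler_node.simps)
next
  case False
  then have "cell e t = j"
    using assms by (intro cell_eq) auto
  then show ?thesis by (simp add: euler_def)
qed

lemma euler_0: "0 < e \<Longrightarrow> euler f X e 0 = 0"
  using euler_on_cell[of e 0 0 f X] by simp

lemma has_integral_euler_cell:
  assumes e: "0 < e" and s: "real j * e \<le> s" "s \<le> t" "t \<le> (real j + 1) * e"
  shows "((\<lambda>r. f (euler_arg f X e (cell e r))) has_integral (euler f X e t - euler f X e s)) {s..t}"
proof -
  have I: "((\<lambda>r. f (euler_arg f X e j)) has_integral (t - s) * f (euler_arg f X e j)) {s..t}"
    using has_integral_const_real[of "f (euler_arg f X e j)" s t] s by simp
  have eq: "euler f X e t - euler f X e s = (t - s) * f (euler_arg f X e j)"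
    using euler_on_cell[of e j t f X] euler_on_cell[of e j s f X] assms
    by (simp add: algebra_simps)
  \<comment> \<open>Only at \<open>r = t\<close>, possibly the right end of the cell, can the index
    differ from \<open>j\<close>, and one point does not affect the integral.\<close>
  have "f (euler_arg f X e (cell e r)) = f (euler_arg f X e j)" if "r \<in> {s..t} - {t}" for r
  proof -
    have "cell e r = j"
      using that assms by (intro cell_eq) auto
    then show ?thesis by simp
  qed
  from has_integral_spike_finite[OF finite.insertI[OF finite.emptyI] this I] show ?thesis
    unfolding eq .
qed

text \<open>Full cells are glued by induction up to the last node before \<open>t\<close>; then the
  unfinished cell is added.\<close>

lemma has_integral_euler_0:
  assumes e: "0 < e" and t: "0 \<le> t"
  shows "((\<lambda>r. f (euler_arg f X e (cell e r))) has_integral euler f X e t) {0..t}"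
proof -
  have nodes: "((\<lambda>r. f (euler_arg f X e (cell e r))) has_integral euler f X e (real j * e))
     {0..real j * e}" for j
  proof (induction j)
    case 0
    then show ?case using euler_0[OF e, of f X] has_integral_refl(2)[of _ "0::real"] by simp
  next
    case (Suc j)
    have "((\<lambda>r. f (euler_arg f X e (cell e r))) has_integral
        (euler f X e (real (Suc j) * e) - euler f X e (real j * e))) {real j * e..real (Suc j) * e}"
      using e by (intro has_integral_euler_cell[where j=j]) (auto simp: field_simps)
    from has_integral_combine[OF _ _ Suc this] show ?case
      using e by (simp add: field_simps)
  qed
  define j where "j = cell e t"
  have j: "real j * e \<le> t" "t < (real j + 1) * e"
    using cell_bounds[OF assms] by (auto simp: j_def)
  have "((\<lambda>r. f (euler_arg f X e (cell e r))) has_integral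
      (euler f X e t - euler f X e (real j * e))) {real j * e..t}"
    using j e by (intro has_integral_euler_cell[where j=j]) auto
  from has_integral_combine[OF _ j(1) nodes this] show ?thesis
    using e by simp
qed

lemma has_integral_euler:
  assumes e: "0 < e" and st: "0 \<le> s" "s \<le> t"
  shows "((\<lambda>r. f (euler_arg f X e (cell e r))) has_integral (euler f X e t - euler f X e s)) {s..t}"
proof -
  have t: "((\<lambda>r. f (euler_arg f X e (cell e r))) has_integral euler f X e t) {0..t}"
    using has_integral_euler_0[OF e] st by auto
  then have "(\<lambda>r. f (euler_arg f X e (cell e r))) integrable_on {s..t}"
    using st by (meson has_integral_integrable integrable_subinterval_real order.refl atLeastatMost_subset_iff)
  then obtain I where I: "((\<lambda>r. f (euler_arg f X e (cell e r))) has_integral I) {s..t}"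
    by blast
  have "((\<lambda>r. f (euler_arg f X e (cell e r))) has_integral euler f X e s + I) {0..t}"
    using has_integral_combine[OF st has_integral_euler_0[OF e st(1)] I] .
  from has_integral_unique[OF this t] show ?thesis
    using I by (metis add_diff_cancel_left')
qed

section \<open>Lipschitz bounds and derivative of the Euler polygon\<close>

lemma euler_increment_bounds:
  assumes e: "0 < e" and st: "0 \<le> s" "s \<le> t" and f: "\<And>u. 0 \<le> f u" "\<And>u. f u \<le> K"
  shows "0 \<le> euler f X e t - euler f X e s" "euler f X e t - euler f X e s \<le> K * (t - s)"
proof -
  note I = has_integral_euler[OF e st, of f X]
  show "0 \<le> euler f X e t - euler f X e s"
    by (rule has_integral_nonneg[OF I]) (use f in auto)
  show "euler f X e t - euler f X e s \<le> K * (t - s)"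
    using has_integral_le[OF I has_integral_const_real[of K s t]] f st by (auto simp: mult.commute)
qed

lemma continuous_on_lipschitz_bound:
  fixes g :: "real \<Rightarrow> real"
  assumes "\<And>s t. s \<in> S \<Longrightarrow> t \<in> S \<Longrightarrow> s \<le> t \<Longrightarrow> \<bar>g t - g s\<bar> \<le> K * (t - s)" "0 \<le> K"
  shows "continuous_on S g"
proof -
  have "K-lipschitz_on S g"
  proof (rule lipschitz_onI)
    fix s t assume st: "s \<in> S" "t \<in> S"
    show "dist (g s) (g t) \<le> K * dist s t"
    proof (cases "s \<le> t")
      case True
      then show ?thesis
        using assms(1)[OF st True] by (simp add: dist_real_def abs_minus_commute)
    next
      case False
      then show ?thesis
        using assms(1)[OF st(2,1)] by (simp add: dist_real_def)
    qed
  qed fact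
  then show ?thesis by (rule lipschitz_on_continuous_on)
qed

lemma euler_Lipschitz:
  assumes e: "0 < e" and st: "0 \<le> s" "s \<le> t" and f: "\<And>u. 0 \<le> f u" "\<And>u. f u \<le> K"
  shows "\<bar>euler f X e t - euler f X e s\<bar> \<le> K * (t - s)"
  using euler_increment_bounds[where f=f and X=X, OF assms] by auto

lemma continuous_on_euler:
  assumes e: "0 < e" and f: "\<And>u. 0 \<le> f u" "\<And>u. f u \<le> K"
  shows "continuous_on {0..} (euler f X e)"
proof (rule continuous_on_lipschitz_bound)
  show "0 \<le> K" using f(1)[of 0] f(2)[of 0] by linarith
  fix s t :: real assume "s \<in> {0..}" "s \<le> t"
  then show "\<bar>euler f X e t - euler f X e s\<bar> \<le> K * (t - s)"
    using f by (intro euler_Lipschitz e) auto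
qed

lemma euler_has_derivative:
  assumes e: "0 < e" and t: "0 < t" "t \<noteq> real (cell e t) * e"
  shows "(euler f X e has_vector_derivative f (euler_arg f X e (cell e t))) (at t)"
proof -
  define j where "j = cell e t"
  have j: "real j * e < t" "t < (real j + 1) * e"
    using cell_bounds[of e t] assms by (auto simp: j_def)
  have "((\<lambda>t. euler_node f X e j + (t - real j * e) * f (euler_arg f X e j))
      has_vector_derivative f (euler_arg f X e j)) (at t)"
    unfolding has_real_derivative_iff_has_vector_derivative[symmetric]
    by (auto intro!: derivative_eq_intros)
  then show ?thesis
    unfolding j_def[symmetric]
    by (rule has_vector_derivative_transform_within_open[where S="{real j * e<..<(real j + 1) * e}"])
       (use j e euler_on_cell[OF e, of j _ f X] in auto)
qed

text \<open>Monotonicity of \<open>f\<close> turns the squared distance of two Euler polygons into a quantity whose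
  growth is controlled by the discretisation error of the path alone.\<close>

lemma euler_sq_diff_rate:
  fixes f X :: "real \<Rightarrow> real"
  assumes e: "0 < e" "0 < e'" and f: "\<And>u. 0 \<le> f u" "\<And>u. f u \<le> K" "mono f" and t: "0 \<le> t"
    "t \<le> T"
  defines "D \<equiv> euler f X e t - euler f X e' t"
    and "r \<equiv> f (euler_arg f X e (cell e t)) - f (euler_arg f X e' (cell e' t))"
    and "err \<equiv> (\<lambda>e. min (K * T) (\<bar>X (real (cell e t) * e) - X t\<bar> + K * e))"
  shows "D * r \<le> K * (err e + err e')"
proof -
  define a where "a e = euler_arg f X e (cell e t)" for e
  have K: "0 \<le> K" using f(1)[of 0] f(2)[of 0] by linarith
  have r: "\<bar>r\<bar> \<le> K" unfolding r_def using f(1,2)[of "a e"] f(1,2)[of "a e'"]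
    by (auto simp: a_def)
  have euler: "\<bar>euler f X e t - euler_node f X e (cell e t)\<bar> \<le> K * e" if "0 < e" for e
  proof -
    have "\<bar>euler f X e t - euler_node f X e (cell e t)\<bar> = (t - real (cell e t) * e) * f (a e)"
      unfolding euler_def a_def using f(1) cell_bounds[OF that t(1)] by (simp add: abs_mult)
    also have "\<dots> \<le> e * K"
      using cell_bounds[OF that t(1)] f(1,2) that by (intro mult_mono) (auto simp: algebra_simps)
    finally show ?thesis by (simp add: mult.commute)
  qed
  have "\<bar>D\<bar> \<le> K * T"
  proof -
    have "0 \<le> euler f X e t" "euler f X e t \<le> K * t" "0 \<le> euler f X e' t" "euler f X e' t \<le> K * t"
      using euler_increment_bounds[where f=f and X=X, OF e(1) order.refl t(1) f(1,2)]
        euler_increment_bounds[where f=f and X=X, OF e(2) order.refl t(1) f(1,2)]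
      by (auto simp: euler_0 e)
    then have "\<bar>D\<bar> \<le> K * t" by (auto simp: D_def)
    also have "\<dots> \<le> K * T" using t K by (intro mult_left_mono)
    finally show ?thesis .
  qed
  then have "\<bar>D\<bar> * \<bar>r\<bar> \<le> (K * T) * K"
    using r K by (intro mult_mono') auto
  moreover have "D * r \<le> \<bar>D\<bar> * \<bar>r\<bar>"
    using abs_ge_self[of "D * r"] by (simp add: abs_mult)
  ultimately have 1: "D * r \<le> K * (K * T)"
    by (simp add: mult_ac)
  define E where "E = (\<bar>X (real (cell e t) * e) - X t\<bar> + K * e) + (\<bar>X (real (cell e' t) * e') - X t\<bar> + K * e')"
  have mono: "0 \<le> (a e - a e') * r"
    using monoD[OF f(3), of "a e" "a e'"] monoD[OF f(3), of "a e'" "a e"]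
    unfolding r_def a_def[symmetric]
    by (cases "a e \<le> a e'") (auto simp: mult_nonpos_nonpos)
  \<comment> \<open>Each frozen argument \<open>a e\<close> equals
    \<open>X t - euler f X e t\<close> up to its own summand of \<open>E\<close>, so
    \<open>a e - a e'\<close> is \<open>- D\<close> up to \<open>E\<close>. Since
    \<open>(a e - a e') * r\<close> is nonnegative by monotonicity of \<open>f\<close>, dropping it
    leaves \<open>D * r \<le> K * E\<close>.\<close>
  have "\<bar>D + (a e - a e')\<bar> \<le> E"
    using euler[OF e(1)] euler[OF e(2)] unfolding D_def a_def E_def euler_arg_def by linarith
  then have "\<bar>D + (a e - a e')\<bar> * \<bar>r\<bar> \<le> E * K"
    using r K by (intro mult_mono') auto
  moreover have "(D + (a e - a e')) * r \<le> \<bar>D + (a e - a e')\<bar> * \<bar>r\<bar>"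
    using abs_ge_self[of "(D + (a e - a e')) * r"] by (simp add: abs_mult)
  ultimately have "(D + (a e - a e')) * r \<le> E * K"
    by linarith
  then have 2: "D * r \<le> K * E"
    using mono by (simp only: ring_distribs mult.commute[of E K])
  define x x' where "x = \<bar>X (real (cell e t) * e) - X t\<bar> + K * e"
    and "x' = \<bar>X (real (cell e' t) * e') - X t\<bar> + K * e'"
  have "0 \<le> K * T" "0 \<le> x" "0 \<le> x'"
    using K t e by (auto simp: x_def x'_def)
  \<comment> \<open>Truncation at a nonnegative constant is subadditive, so the crude bound and the
    error bound merge into separate truncated errors for \<open>e\<close> and
    \<open>e'\<close>.\<close>
  then have "min (K * T) (x + x') \<le> min (K * T) x + min (K * T) x'"
    by linarith
  then have "min (K * T) E \<le> err e + err e'"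
    unfolding err_def E_def x_def x'_def .
  then have "K * min (K * T) E \<le> K * (err e + err e')"
    using K by (rule mult_left_mono)
  moreover have "D * r \<le> K * min (K * T) E"
    using 1 2 by (cases "K * T \<le> E") (auto simp: min_def)
  ultimately show ?thesis
    by linarith
qed

section \<open>Regularity of cadlag paths\<close>

text \<open>On each grid cell the process is replaced by its value at the right end, a countable
  patchwork of random variables; right-continuity makes these approximations converge
  pointwise.\<close>

lemma right_continuous_process_measurable:
  fixes Y :: "real \<Rightarrow> 'a \<Rightarrow> real"
  assumes meas: "\<And>t. 0 \<le> t \<Longrightarrow> Y t \<in> borel_measurable M"
    and cont: "\<And>t \<omega>. 0 \<le> t \<Longrightarrow> \<omega> \<in> space M \<Longrightarrow> continuous (at_right t) (\<lambda>t. Y t \<omega>)"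
  shows "(\<lambda>(\<omega>, t). Y (max 0 t) \<omega>) \<in> borel_measurable (M \<Otimes>\<^sub>M borel)"
proof (rule borel_measurable_LIMSEQ_real)
  \<comment> \<open>The index \<open>cell + 1\<close> puts \<open>q n t\<close> strictly to the
    right of a nonnegative \<open>t\<close>, as convergence along \<open>at_right\<close>
    requires.\<close>
  define q :: "nat \<Rightarrow> real \<Rightarrow> real" where "q n t = real (cell (1 / real (Suc n)) t + 1) / real (Suc n)" for n t
  define Z where "Z n = (\<lambda>(\<omega>, t). Y (q n (max 0 t)) \<omega>)" for n
  show "Z n \<in> borel_measurable (M \<Otimes>\<^sub>M borel)" for n
  proof -
    have "(\<lambda>x. Y (real (cell (1 / real (Suc n)) (max 0 (snd x)) + 1) / real (Suc n)) (fst x)) \<in> borel_measurable (M \<Otimes>\<^sub>M borel)"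
    proof (rule measurable_compose_countable[where g="\<lambda>x. cell (1 / real (Suc n)) (max 0 (snd x))"])
      fix i :: nat
      have "Y (real (i + 1) / real (Suc n)) \<in> borel_measurable M"
        by (intro meas) auto
      then show "(\<lambda>x. Y (real (i + 1) / real (Suc n)) (fst x)) \<in> borel_measurable (M \<Otimes>\<^sub>M borel)"
        by measurable
    qed measurable
    then show ?thesis
      by (simp add: Z_def q_def case_prod_beta')
  qed
  fix z assume "z \<in> space (M \<Otimes>\<^sub>M (borel :: real measure))"
  then obtain \<omega> t where z: "z = (\<omega>, t)" and \<omega>: "\<omega> \<in> space M"
    by (auto simp: space_pair_measure)
  define u where "u = max 0 t"
  have u: "0 \<le> u" by (simp add: u_def)
  have q: "u < q n u" "q n u \<le> u + 1 / real (Suc n)" for n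
  proof -
    define c where "c = real (cell (1 / real (Suc n)) u)"
    have "q n u = (c + 1) * (1 / real (Suc n))"
      by (simp add: q_def c_def)
    moreover have "c * (1 / real (Suc n)) \<le> u" "u < (c + 1) * (1 / real (Suc n))"
      using cell_bounds[of "1 / real (Suc n)" u] u unfolding c_def by simp_all
    ultimately show "u < q n u" "q n u \<le> u + 1 / real (Suc n)"
      by (simp_all only: ring_distribs mult_1_left)
  qed
  have "(\<lambda>n. q n u) \<longlonglongrightarrow> u"
  proof (rule real_tendsto_sandwich)
    show "\<forall>\<^sub>F n in sequentially. u \<le> q n u" "\<forall>\<^sub>F n in sequentially. q n u \<le> u + 1 / real (Suc n)"
      using q by (auto intro!: always_eventually less_imp_le)
    show "(\<lambda>n. u + 1 / real (Suc n)) \<longlonglongrightarrow> u"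
      using tendsto_add[OF tendsto_const LIMSEQ_inverse_real_of_nat, of u] by (simp add: inverse_eq_divide)
  qed auto
  then have "filterlim (\<lambda>n. q n u) (at_right u) sequentially"
    using q by (intro filterlim_at_withinI always_eventually) auto
  moreover have "((\<lambda>t. Y t \<omega>) \<longlongrightarrow> Y u \<omega>) (at_right u)"
    using cont[OF u \<omega>] by (simp add: continuous_within)
  ultimately have "(\<lambda>n. Y (q n u) \<omega>) \<longlonglongrightarrow> Y u \<omega>"
    by (rule filterlim_compose[rotated])
  then show "(\<lambda>n. Z n z) \<longlonglongrightarrow> (case z of (\<omega>, t) \<Rightarrow> Y (max 0 t) \<omega>)"
    by (simp add: Z_def z u_def)
qed

lemma cadlag_measurable:
  assumes "cadlag f"
  shows "(\<lambda>t. f (max 0 t)) \<in> borel_measurable borel"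
proof -
  \<comment> \<open>A single path is treated as a process on a one-point space.\<close>
  have "(\<lambda>(\<omega>, t). f (max 0 t)) \<in> borel_measurable (count_space (UNIV :: unit set) \<Otimes>\<^sub>M borel)"
    using assms by (intro right_continuous_process_measurable) (auto simp: cadlag_def)
  from measurable_compose[OF measurable_Pair1'[of "()"] this] show ?thesis
    by simp
qed

text \<open>One-sided limits make the oscillation small on either side of any point of
  \<open>{0..T}\<close>, so no other time close to it belongs to the set. The set therefore has no
  limit point in a compact interval.\<close>

lemma cadlag_finite_large_jumps:
  assumes "cadlag f" "0 < \<epsilon>"
  shows "finite {t \<in> {0<..T}. \<not> (\<forall>\<^sub>F s in at_left t. \<bar>f s - f t\<bar> < \<epsilon>)}" (is "finite ?J")
proof -
  have near: "\<exists>l. \<forall>\<^sub>F s in F. \<bar>f s - l\<bar> < \<epsilon> / 2" if "(f \<longlongrightarrow> l) F" for l and F :: "real filter"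
    using tendstoD[OF that, of "\<epsilon> / 2"] assms(2) by (auto simp: dist_real_def)
  have "\<not> t islimpt ?J" if t: "t \<in> {0..T}" for t
  proof -
    obtain l where "\<forall>\<^sub>F s in at_right t. \<bar>f s - l\<bar> < \<epsilon> / 2"
      using assms(1) t near[of "f t" "at_right t"] by (auto simp: cadlag_def continuous_within)
    then obtain b where b: "t < b" "\<And>s. t < s \<Longrightarrow> s < b \<Longrightarrow> \<bar>f s - l\<bar> < \<epsilon> / 2"
      by (auto simp: eventually_at_right_field)
    \<comment> \<open>The guard \<open>0 < s\<close> makes this vacuous at \<open>t = 0\<close>,
      where no left limit is available.\<close>
    have "\<exists>a<t. \<exists>l. \<forall>s. 0 < s \<longrightarrow> a < s \<longrightarrow> s < t \<longrightarrow> \<bar>f s - l\<bar> < \<epsilon> / 2"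
    proof (cases "t = 0")
      case True
      then show ?thesis by (auto intro!: exI[of _ "-1"])
    next
      case False
      then obtain l where "\<forall>\<^sub>F s in at_left t. \<bar>f s - l\<bar> < \<epsilon> / 2"
        using assms(1) t near[of _ "at_left t"] by (fastforce simp: cadlag_def)
      then show ?thesis
        by (auto simp: eventually_at_left_field)
    qed
    then obtain a l' where a: "a < t" "\<And>s. 0 < s \<Longrightarrow> a < s \<Longrightarrow> s < t \<Longrightarrow> \<bar>f s - l'\<bar> < \<epsilon> / 2"
      by blast
    have notJ: "s \<notin> ?J" if s: "a < s" "s < b" "s \<noteq> t" for s
    proof
      assume J: "s \<in> ?J"
      then have s0: "0 < s" by simp
      have "\<exists>c<s. \<forall>r. c < r \<longrightarrow> r < s \<longrightarrow> \<bar>f r - f s\<bar> < \<epsilon>"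
      proof (cases "s < t")
        case True
        have "\<bar>f r - f s\<bar> < \<epsilon>" if "max 0 a < r" "r < s" for r
        proof -
          have "\<bar>f r - l'\<bar> < \<epsilon> / 2" "\<bar>f s - l'\<bar> < \<epsilon> / 2"
            using a(2)[of r] a(2)[of s] that True s s0 by auto
          then show ?thesis by linarith
        qed
        then show ?thesis using s s0 by (intro exI[of _ "max 0 a"]) auto
      next
        case False
        have "\<bar>f r - f s\<bar> < \<epsilon>" if "t < r" "r < s" for r
        proof -
          have "\<bar>f r - l\<bar> < \<epsilon> / 2" "\<bar>f s - l\<bar> < \<epsilon> / 2"
            using b(2)[of r] b(2)[of s] that False s by auto
          then show ?thesis by linarith
        qed
        then show ?thesis using s False by (intro exI[of _ t]) auto
      qed
      then show False using J by (auto simp: eventually_at_left_field)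
    qed
    show ?thesis
    proof
      assume "t islimpt ?J"
      moreover have "t \<in> {a<..<b}" "open {a<..<b}" using a(1) b(1) by simp_all
      ultimately obtain s where "s \<in> ?J" "s \<in> {a<..<b}" "s \<noteq> t"
        by (rule islimptE)
      then show False using notJ[of s] by simp
    qed
  qed
  then have "finite ({0..T} \<inter> ?J)"
    by (intro finite_not_islimpt_in_compact) auto
  then show ?thesis
    by (rule rev_finite_subset) auto
qed

text \<open>By right-continuity a discontinuity is a failure on the left, detected by some threshold
  \<open>1 / (m + 1)\<close> and horizon \<open>n\<close>; each of these countably many sets is
  finite.\<close>

lemma cadlag_countable_discontinuities:
  assumes "cadlag f"
  shows "countable {t. 0 < t \<and> \<not> isCont f t}"
proof -
  define J where "J n m = {t \<in> {0<..real n}. \<not> (\<forall>\<^sub>F s in at_left t. \<bar>f s - f t\<bar> < 1 / real (Suc m))}" for n m :: nat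
  have "{t. 0 < t \<and> \<not> isCont f t} \<subseteq> (\<Union>n. \<Union>m. J n m)"
  proof safe
    fix t :: real assume t: "0 < t" "\<not> isCont f t"
    have "\<not> (f \<longlongrightarrow> f t) (at_left t)"
      using assms t by (auto simp: cadlag_def continuous_within filterlim_at_split)
    then obtain e where e: "0 < e" "\<not> (\<forall>\<^sub>F s in at_left t. \<bar>f s - f t\<bar> < e)"
      by (auto simp: tendsto_iff dist_real_def)
    obtain m where m: "1 / real (Suc m) < e"
      using e(1) nat_approx_posE by blast
    obtain n :: nat where "t \<le> real n" using real_arch_simple by blast
    moreover have "\<not> (\<forall>\<^sub>F s in at_left t. \<bar>f s - f t\<bar> < 1 / real (Suc m))"
    proof
      assume "\<forall>\<^sub>F s in at_left t. \<bar>f s - f t\<bar> < 1 / real (Suc m)"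
      then have "\<forall>\<^sub>F s in at_left t. \<bar>f s - f t\<bar> < e"
        by (rule eventually_mono) (use m in linarith)
      then show False using e(2) by simp
    qed
    ultimately have "t \<in> J n m" using t by (auto simp: J_def)
    then show "t \<in> (\<Union>n. \<Union>m. J n m)" by blast
  qed
  moreover have "countable (\<Union>n. \<Union>m. J n m)"
    unfolding J_def
    by (intro countable_UN[OF countableI_type] countable_finite cadlag_finite_large_jumps[OF assms]) simp
  ultimately show ?thesis
    by (rule countable_subset)
qed

lemma cadlag_AE_isCont:
  assumes "cadlag f"
  shows "AE t in lborel. 0 < t \<longrightarrow> isCont f t"
proof -
  have "{t. 0 < t \<and> \<not> isCont f t} \<in> null_sets lborel"
    using cadlag_countable_discontinuities[OF assms] by (rule countable_imp_null_set_lborel)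
  then show ?thesis
    by (rule AE_I') blast
qed

section \<open>Convergence of the Euler schemes\<close>

text \<open>The error term of \<open>euler_sq_diff_rate\<close> as a function of time. Truncation at
  \<open>K * T\<close> supplies a constant majorant for dominated convergence.\<close>

definition euler_err :: "(real \<Rightarrow> real) \<Rightarrow> real \<Rightarrow> real \<Rightarrow> real \<Rightarrow> real \<Rightarrow> real" where
  "euler_err X K T e t = min (K * T) (\<bar>X (real (cell e t) * e) - X t\<bar> + K * e)"

section \<open>Vanishing of the integrated discretisation error\<close>

lemma set_integrable_bounded_Icc:
  fixes g :: "real \<Rightarrow> real"
  assumes "set_borel_measurable lborel {a..b} g" "\<And>t. t \<in> {a..b} \<Longrightarrow> \<bar>g t\<bar> \<le> B"
  shows "set_integrable lborel {a..b} g"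
proof -
  have "integrable lborel (\<lambda>t. indicator {a..b} t *\<^sub>R B)"
    by (simp add: emeasure_lborel_Icc_eq integrable_mult_left_iff)
  then show ?thesis
    unfolding set_integrable_def
    by (rule Bochner_Integration.integrable_bound)
       (use assms in \<open>auto simp: set_borel_measurable_def indicator_def intro!: always_eventually order.trans[OF _ abs_ge_self]\<close>)
qed

lemma measurable_cell_path:
  "(\<lambda>t. g (cell e t) :: real) \<in> borel_measurable borel"
  by (rule measurable_compose[OF measurable_cell]) simp

lemma euler_err_measurable:
  assumes "cadlag X"
  shows "set_borel_measurable lborel {0..T} (euler_err X K T' e)"
proof -
  have "(\<lambda>t. min (K * T') (\<bar>X (real (cell e t) * e) - X (max 0 t)\<bar> + K * e)) \<in> borel_measurable borel"
    using cadlag_measurable[OF assms] measurable_cell_path[of "\<lambda>j. X (real j * e)" e] by simp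
  then have "(\<lambda>t. indicator {0..T} t *\<^sub>R min (K * T') (\<bar>X (real (cell e t) * e) - X (max 0 t)\<bar> + K * e)) \<in> borel_measurable lborel"
    by simp
  also have "?this \<longleftrightarrow> ?thesis"
    unfolding set_borel_measurable_def
    by (intro measurable_cong) (auto simp: indicator_def euler_err_def max_def)
  finally show ?thesis .
qed

lemma euler_err_bounds:
  assumes "0 \<le> K" "0 < e" "0 \<le> T"
  shows "0 \<le> euler_err X K T e t" "euler_err X K T e t \<le> K * T"
  using assms by (auto simp: euler_err_def)

lemma euler_err_integrable:
  assumes "cadlag X" "0 \<le> K" "0 < e" "0 \<le> T"
  shows "set_integrable lborel {0..T} (euler_err X K T e)"
proof (rule set_integrable_bounded_Icc[OF euler_err_measurable[OF assms(1)]])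
  show "\<bar>euler_err X K T e t\<bar> \<le> K * T" for t
    using euler_err_bounds[OF assms(2-4), of X t] by simp
qed

lemma tendsto_cell:
  assumes "0 \<le> t"
  shows "(\<lambda>n. real (cell (1 / real (Suc n)) t) * (1 / real (Suc n))) \<longlonglongrightarrow> t"
proof (rule real_tendsto_sandwich)
  have *: "real (cell (1 / real (Suc n)) t) * (1 / real (Suc n)) \<le> t"
    "t - 1 / real (Suc n) \<le> real (cell (1 / real (Suc n)) t) * (1 / real (Suc n))" for n
  proof -
    show "real (cell (1 / real (Suc n)) t) * (1 / real (Suc n)) \<le> t"
      using assms by (intro cell_bounds) auto
    have "t < (real (cell (1 / real (Suc n)) t) + 1) * (1 / real (Suc n))"
      using assms by (intro cell_bounds) auto
    then show "t - 1 / real (Suc n) \<le> real (cell (1 / real (Suc n)) t) * (1 / real (Suc n))"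
      by (simp only: ring_distribs mult_1_left)
  qed
  show "\<forall>\<^sub>F n in sequentially. t - 1 / real (Suc n) \<le> real (cell (1 / real (Suc n)) t) * (1 / real (Suc n))"
    "\<forall>\<^sub>F n in sequentially. real (cell (1 / real (Suc n)) t) * (1 / real (Suc n)) \<le> t"
    using * by simp_all
  show "(\<lambda>n. t - 1 / real (Suc n)) \<longlonglongrightarrow> t"
    using tendsto_diff[OF tendsto_const LIMSEQ_inverse_real_of_nat, of t] by (simp add: inverse_eq_divide)
qed simp

lemma tendsto_set_lebesgue_integral_bounded:
  fixes g :: "nat \<Rightarrow> real \<Rightarrow> real"
  assumes "\<And>n. set_borel_measurable lborel {a..b} (g n)" "set_borel_measurable lborel {a..b} h"
    and "\<And>n t. t \<in> {a..b} \<Longrightarrow> \<bar>g n t\<bar> \<le> B"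
    and lim: "AE t in lborel. t \<in> {a..b} \<longrightarrow> (\<lambda>n. g n t) \<longlonglongrightarrow> h t"
  shows "(\<lambda>n. LINT t:{a..b}|lborel. g n t) \<longlonglongrightarrow> (LINT t:{a..b}|lborel. h t)"
  unfolding set_lebesgue_integral_def
proof (rule integral_dominated_convergence)
  show "integrable lborel (\<lambda>t. indicator {a..b} t *\<^sub>R B)"
    by (simp add: emeasure_lborel_Icc_eq integrable_mult_left_iff)
  show "AE t in lborel. (\<lambda>n. indicator {a..b} t *\<^sub>R g n t) \<longlonglongrightarrow> indicator {a..b} t *\<^sub>R h t"
    using lim by eventually_elim (auto simp: indicator_def)
qed (use assms in \<open>auto simp: set_borel_measurable_def indicator_def\<close>)

text \<open>The grid point below \<open>t\<close> converges to \<open>t\<close>, and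
  \<open>X\<close> is continuous at almost every \<open>t\<close> because its discontinuities are
  countable.\<close>

lemma euler_err_tendsto_0:
  assumes X: "cadlag X" and K: "0 \<le> K" and T: "0 \<le> T"
  shows "(\<lambda>n. LINT t:{0..T}|lborel. euler_err X K T (1 / real (Suc n)) t) \<longlonglongrightarrow> 0"
proof -
  have "AE t in lborel. t \<in> {0..T} \<longrightarrow> (\<lambda>n. euler_err X K T (1 / real (Suc n)) t) \<longlonglongrightarrow> 0"
  proof -
    have "AE t in lborel. t \<noteq> (0::real)"
      by (rule AE_lborel_singleton)
    with cadlag_AE_isCont[OF X] show ?thesis
    proof eventually_elim
      case (elim t)
      show ?case
      proof
        assume t: "t \<in> {0..T}"
        have "(\<lambda>n. X (real (cell (1 / real (Suc n)) t) * (1 / real (Suc n)))) \<longlonglongrightarrow> X t"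
          using elim t by (intro isCont_tendsto_compose[of t X] tendsto_cell) auto
        then have "(\<lambda>n. min (K * T) (\<bar>X (real (cell (1 / real (Suc n)) t) * (1 / real (Suc n))) - X t\<bar> + K * (1 / real (Suc n))))
          \<longlonglongrightarrow> min (K * T) (\<bar>X t - X t\<bar> + K * 0)"
          using LIMSEQ_inverse_real_of_nat
          by (intro tendsto_intros) (simp_all add: inverse_eq_divide)
        then show "(\<lambda>n. euler_err X K T (1 / real (Suc n)) t) \<longlonglongrightarrow> 0"
          using mult_nonneg_nonneg[OF K T] by (simp add: euler_err_def min_absorb2)
      qed
    qed
  qed
  moreover have "\<bar>euler_err X K T (1 / real (Suc n)) t\<bar> \<le> K * T" for n t
    using euler_err_bounds[OF K _ T, of "1 / real (Suc n)" X t] by simp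
  ultimately have "(\<lambda>n. LINT t:{0..T}|lborel. euler_err X K T (1 / real (Suc n)) t)
      \<longlonglongrightarrow> (LINT t:{0..T}|lborel. 0)"
    by (intro tendsto_set_lebesgue_integral_bounded euler_err_measurable[OF X])
       (auto simp: set_borel_measurable_def)
  then show ?thesis by simp
qed

lemma finite_grid_points:
  assumes e: "0 < e"
  shows "finite {t \<in> {0..T}. t = real (cell e t) * e}"
proof (rule finite_subset)
  show "{t \<in> {0..T}. t = real (cell e t) * e} \<subseteq> (\<lambda>j. real j * e) ` {..cell e T}"
  proof
    fix t assume t: "t \<in> {t \<in> {0..T}. t = real (cell e t) * e}"
    then have "cell e t \<le> cell e T"
      using e unfolding cell_def by (intro nat_mono floor_mono divide_right_mono) auto
    with t show "t \<in> (\<lambda>j. real j * e) ` {..cell e T}" by blast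
  qed
qed simp

text \<open>The rate \<open>2 * (D t * r t)\<close> of the squared distance is integrated from
  \<open>D 0 = 0\<close>. The finitely many grid points, where the polygons may have corners, form
  the exceptional set of the fundamental theorem of calculus.\<close>

lemma euler_sq_diff:
  fixes f X :: "real \<Rightarrow> real"
  assumes X: "cadlag X" and e: "0 < e" "0 < e'" and f: "\<And>u. 0 \<le> f u" "\<And>u. f u \<le> K" "mono f"
    and T: "0 \<le> T"
  shows "(euler f X e T - euler f X e' T)\<^sup>2 \<le>
    2 * K * ((LINT t:{0..T}|lborel. euler_err X K T e t) + (LINT t:{0..T}|lborel. euler_err X K T e' t))"
proof -
  have K: "0 \<le> K" using f(1)[of 0] f(2)[of 0] by linarith
  define D where "D t = euler f X e t - euler f X e' t" for t
  define r where "r t = f (euler_arg f X e (cell e t)) - f (euler_arg f X e' (cell e' t))" for t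
  define S where "S = {t \<in> {0..T}. t = real (cell e t) * e} \<union> {t \<in> {0..T}. t = real (cell e' t) * e'}"
  have "((\<lambda>t. 2 * (D t * r t)) has_integral ((D T)\<^sup>2 - (D 0)\<^sup>2)) {0..T}"
  proof (rule fundamental_theorem_of_calculus_interior_strong[where S=S])
    show "finite S" unfolding S_def using finite_grid_points e by simp
    show "continuous_on {0..T} (\<lambda>t. (D t)\<^sup>2)"
      unfolding D_def using continuous_on_euler[where f=f and X=X, OF e(1) f(1,2)]
        continuous_on_euler[where f=f and X=X, OF e(2) f(1,2)]
      by (intro continuous_intros) (auto elim!: continuous_on_subset)
    fix t assume t: "t \<in> {0<..<T} - S"
    have "(D has_vector_derivative r t) (at t)"
      unfolding D_def r_def using t e
      by (intro has_vector_derivative_diff euler_has_derivative) (auto simp: S_def)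
    then have "(D has_real_derivative r t) (at t)"
      by (simp add: has_real_derivative_iff_has_vector_derivative)
    then have "((\<lambda>t. (D t)\<^sup>2) has_real_derivative 2 * (D t * r t)) (at t)"
      by (auto intro!: derivative_eq_intros simp: power2_eq_square)
    then show "((\<lambda>t. (D t)\<^sup>2) has_vector_derivative 2 * (D t * r t)) (at t)"
      by (simp add: has_real_derivative_iff_has_vector_derivative)
  qed fact
  moreover have "D 0 = 0" by (simp add: D_def euler_0 e)
  ultimately have 1: "((\<lambda>t. 2 * (D t * r t)) has_integral (D T)\<^sup>2) {0..T}" by simp
  have err: "(euler_err X K T e has_integral (LINT t:{0..T}|lborel. euler_err X K T e t)) {0..T}" if "0 < e" for e
  proof -
    note int = euler_err_integrable[OF X K that T]
    show ?thesis
      using set_borel_integral_eq_integral[OF int] by (simp add: integrable_integral)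
  qed
  have 2: "((\<lambda>t. 2 * (K * (euler_err X K T e t + euler_err X K T e' t))) has_integral
    2 * (K * ((LINT t:{0..T}|lborel. euler_err X K T e t) + (LINT t:{0..T}|lborel. euler_err X K T e' t)))) {0..T}"
    by (intro has_integral_mult_right has_integral_add err e)
  have "2 * (D t * r t) \<le> 2 * (K * (euler_err X K T e t + euler_err X K T e' t))" if "t \<in> {0..T}" for t
    using euler_sq_diff_rate[OF e f, of t T X] that unfolding D_def r_def euler_err_def by simp
  from has_integral_le[OF 1 2 this] show ?thesis
    by (simp add: D_def mult.assoc)
qed

text \<open>The bound of \<open>euler_sq_diff\<close> is a sum of one term per step size, each
  tending to \<open>0\<close>, so the schemes are Cauchy without a candidate for the limit.\<close>

lemma euler_convergent:
  fixes f X :: "real \<Rightarrow> real"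
  assumes X: "cadlag X" and f: "\<And>u. 0 \<le> f u" "\<And>u. f u \<le> K" "mono f" and T: "0 \<le> T"
  shows "convergent (\<lambda>n. euler f X (1 / real (Suc n)) T)"
proof (rule Cauchy_convergent, rule metric_CauchyI)
  have K: "0 \<le> K" using f(1)[of 0] f(2)[of 0] by linarith
  fix \<epsilon> :: real assume \<epsilon>: "0 < \<epsilon>"
  define G where "G n = 2 * K * (LINT t:{0..T}|lborel. euler_err X K T (1 / real (Suc n)) t)" for n
  have "G \<longlonglongrightarrow> 2 * K * 0"
    unfolding G_def by (intro tendsto_mult_left euler_err_tendsto_0 X K T)
  then have "\<forall>\<^sub>F n in sequentially. G n < \<epsilon>\<^sup>2 / 2"
    using \<epsilon> by (intro order_tendstoD(2)[of G]) auto
  then obtain N where N: "\<And>n. N \<le> n \<Longrightarrow> G n < \<epsilon>\<^sup>2 / 2"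
    by (auto simp: eventually_sequentially)
  show "\<exists>N. \<forall>m\<ge>N. \<forall>n\<ge>N. dist (euler f X (1 / real (Suc m)) T) (euler f X (1 / real (Suc n)) T) < \<epsilon>"
  proof (intro exI allI impI)
    fix m n assume mn: "N \<le> m" "N \<le> n"
    have "(euler f X (1 / real (Suc m)) T - euler f X (1 / real (Suc n)) T)\<^sup>2 \<le> G m + G n"
      using euler_sq_diff[OF X _ _ f T, of "1 / real (Suc m)" "1 / real (Suc n)"]
      by (simp add: G_def ring_distribs)
    also have "\<dots> < \<epsilon>\<^sup>2" using N[OF mn(1)] N[OF mn(2)] by simp
    finally show "dist (euler f X (1 / real (Suc m)) T) (euler f X (1 / real (Suc n)) T) < \<epsilon>"
      using \<epsilon> power2_less_imp_less[of "\<bar>euler f X (1 / real (Suc m)) T - euler f X (1 / real (Suc n)) T\<bar>" \<epsilon>]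
      by (simp add: dist_real_def)
  qed
qed

text \<open>For measurable \<open>f\<close>, a pointwise \<open>lim\<close> along the fixed steps
  \<open>1 / (n + 1)\<close> is a measurable functional of countably many path values even where the
  schemes diverge, so no exceptional null set enters the filtration.\<close>

definition euler_limit :: "(real \<Rightarrow> real) \<Rightarrow> (real \<Rightarrow> real) \<Rightarrow> real \<Rightarrow> real" where
  "euler_limit f X t = lim (\<lambda>n. euler f X (1 / real (Suc n)) t)"

section \<open>The limit along one cadlag path\<close>

context
  fixes f X :: "real \<Rightarrow> real" and K :: real
  assumes X: "cadlag X" and f: "\<And>u. 0 \<le> f u" "\<And>u. f u \<le> K" "mono f"
begin

lemma euler_tendsto:
  assumes "0 \<le> t"
  shows "(\<lambda>n. euler f X (1 / real (Suc n)) t) \<longlonglongrightarrow> euler_limit f X t"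
  unfolding euler_limit_def using euler_convergent[OF X f assms] convergent_LIMSEQ_iff by blast

lemma euler_limit_increment:
  assumes "0 \<le> s" "s \<le> t"
  shows "0 \<le> euler_limit f X t - euler_limit f X s" "euler_limit f X t - euler_limit f X s \<le> K * (t - s)"
proof -
  have lim: "(\<lambda>n. euler f X (1 / real (Suc n)) t - euler f X (1 / real (Suc n)) s)
      \<longlonglongrightarrow> euler_limit f X t - euler_limit f X s"
    using assms by (intro tendsto_diff euler_tendsto) auto
  note * = euler_increment_bounds[where f=f and X=X, OF _ assms f(1,2)]
  show "0 \<le> euler_limit f X t - euler_limit f X s"
    using * by (intro LIMSEQ_le_const[OF lim]) simp
  show "euler_limit f X t - euler_limit f X s \<le> K * (t - s)"
    using * by (intro LIMSEQ_le_const2[OF lim]) simp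
qed

lemma continuous_on_euler_limit: "continuous_on {0..} (euler_limit f X)"
proof (rule continuous_on_lipschitz_bound)
  show "0 \<le> K" using f(1)[of 0] f(2)[of 0] by linarith
  fix s t :: real assume "s \<in> {0..}" "s \<le> t"
  then show "\<bar>euler_limit f X t - euler_limit f X s\<bar> \<le> K * (t - s)"
    using euler_limit_increment[of s t] by simp
qed

lemma right_continuous_solution:
  assumes t: "0 \<le> t"
  shows "continuous (at_right t) (\<lambda>t. X t - euler_limit f X t)"
proof (rule continuous_diff)
  show "continuous (at_right t) X" using X t by (simp add: cadlag_def)
  have "continuous (at t within {0..}) (euler_limit f X)"
    using continuous_on_euler_limit t by (simp add: continuous_on_eq_continuous_within)
  then show "continuous (at_right t) (euler_limit f X)"
    by (rule continuous_within_subset) (use t in auto)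
qed

text \<open>Continuity at \<open>t\<close> handles the path at the grid point below
  \<open>t\<close>. The polygons share the Lipschitz constant \<open>K\<close>, so their values at
  the grid point and at \<open>t\<close> have the same limit.\<close>

lemma euler_arg_tendsto:
  assumes t: "0 \<le> t" "isCont X t"
  shows "(\<lambda>n. euler_arg f X (1 / real (Suc n)) (cell (1 / real (Suc n)) t)) \<longlonglongrightarrow> X t - euler_limit f X t"
proof -
  define c where "c n = real (cell (1 / real (Suc n)) t) * (1 / real (Suc n))" for n
  have c: "0 \<le> c n" "c n \<le> t" for n
    using cell_bounds[of "1 / real (Suc n)" t] t by (simp_all add: c_def)
  have "c \<longlonglongrightarrow> t"
    unfolding c_def using t by (intro tendsto_cell)
  then have X: "(\<lambda>n. X (c n)) \<longlonglongrightarrow> X t"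
    by (rule isCont_tendsto_compose[OF t(2)])
  have "(\<lambda>n. euler f X (1 / real (Suc n)) t - euler f X (1 / real (Suc n)) (c n)) \<longlonglongrightarrow> 0"
  proof (rule real_tendsto_sandwich)
    show "\<forall>\<^sub>F n in sequentially. 0 \<le> euler f X (1 / real (Suc n)) t - euler f X (1 / real (Suc n)) (c n)"
      "\<forall>\<^sub>F n in sequentially. euler f X (1 / real (Suc n)) t - euler f X (1 / real (Suc n)) (c n) \<le> K * (t - c n)"
      using euler_increment_bounds[where f=f and X=X, OF _ c f(1,2)] by simp_all
    show "(\<lambda>n. K * (t - c n)) \<longlonglongrightarrow> 0"
      using tendsto_mult_left[OF tendsto_diff[OF tendsto_const \<open>c \<longlonglongrightarrow> t\<close>], of K t] by simp
  qed simp
  from tendsto_diff[OF X tendsto_diff[OF euler_tendsto[OF t(1)] this]]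
  have "(\<lambda>n. X (c n) - euler f X (1 / real (Suc n)) (c n)) \<longlonglongrightarrow> X t - euler_limit f X t" by simp
  moreover have "euler f X (1 / real (Suc n)) (c n) = euler_node f X (1 / real (Suc n)) (cell (1 / real (Suc n)) t)" for n
    using euler_on_cell[of "1 / real (Suc n)" "cell (1 / real (Suc n)) t" "c n" f X]
    by (simp add: c_def divide_right_mono)
  ultimately show ?thesis
    unfolding euler_arg_def c_def by simp
qed

lemma solution_measurable: "(\<lambda>t. X (max 0 t) - euler_limit f X (max 0 t)) \<in> borel_measurable borel"
proof (rule borel_measurable_diff[OF cadlag_measurable[OF X]])
  have "continuous_on UNIV (\<lambda>t. euler_limit f X (max 0 t))"
    by (rule continuous_on_compose2[OF continuous_on_euler_limit]) (auto intro!: continuous_intros)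
  then show "(\<lambda>t. euler_limit f X (max 0 t)) \<in> borel_measurable borel"
    by (rule borel_measurable_continuous_onI)
qed

lemma set_borel_measurable_solution:
  assumes "g \<in> borel_measurable borel"
  shows "set_borel_measurable lborel {0..t} (\<lambda>s. g (X s - euler_limit f X s) :: real)"
proof -
  have "(\<lambda>s. indicator {0..t} s *\<^sub>R g (X (max 0 s) - euler_limit f X (max 0 s))) \<in> borel_measurable lborel"
    using measurable_compose[OF solution_measurable assms] by simp
  also have "?this \<longleftrightarrow> ?thesis"
    unfolding set_borel_measurable_def
    by (intro measurable_cong) (auto simp: indicator_def max_def)
  finally show ?thesis .
qed

text \<open>Dominated convergence in \<open>has_integral_euler_0\<close>: the integrands are bounded
  by \<open>K\<close> and converge at every \<open>s\<close> where \<open>X\<close> is continuous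
  and \<open>f\<close> is continuous at the value of the solution.\<close>

lemma euler_limit_integral_equation:
  assumes t: "0 \<le> t" and null: "AE s in lborel. s \<in> {0..t} \<longrightarrow> isCont f (X s - euler_limit f X s)"
  shows "euler_limit f X t = (LINT s:{0..t}|lborel. f (X s - euler_limit f X s))"
proof -
  have f_meas: "f \<in> borel_measurable borel" using f(3) by (rule borel_measurable_mono)
  define r where "r n s = f (euler_arg f X (1 / real (Suc n)) (cell (1 / real (Suc n)) s))" for n s
  have r_meas: "set_borel_measurable lborel {0..t} (r n)" for n
    unfolding r_def set_borel_measurable_def using measurable_cell_path by (intro borel_measurable_scaleR) auto
  have f_bound: "\<bar>f u\<bar> \<le> K" for u using f(1,2)[of u] by simp
  have r_bound: "\<bar>r n s\<bar> \<le> K" for n s using f_bound by (simp add: r_def)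
  have "(\<lambda>n. LINT s:{0..t}|lborel. r n s) \<longlonglongrightarrow> (LINT s:{0..t}|lborel. f (X s - euler_limit f X s))"
  proof (rule tendsto_set_lebesgue_integral_bounded[where B=K])
    have "AE s in lborel. s \<noteq> (0::real)"
      by (rule AE_lborel_singleton)
    with cadlag_AE_isCont[OF X] null
    show "AE s in lborel. s \<in> {0..t} \<longrightarrow> (\<lambda>n. r n s) \<longlonglongrightarrow> f (X s - euler_limit f X s)"
    proof eventually_elim
      case (elim s)
      show ?case
      proof
        assume s: "s \<in> {0..t}"
        with elim have "0 \<le> s" "isCont X s" "isCont f (X s - euler_limit f X s)" by auto
        then show "(\<lambda>n. r n s) \<longlonglongrightarrow> f (X s - euler_limit f X s)"
          unfolding r_def by (intro isCont_tendsto_compose[OF _ euler_arg_tendsto])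
      qed
    qed
  qed (use r_meas r_bound set_borel_measurable_solution[OF f_meas] in auto)
  moreover have "(LINT s:{0..t}|lborel. r n s) = euler f X (1 / real (Suc n)) t" for n
  proof -
    have "set_integrable lborel {0..t} (r n)"
      using r_meas r_bound by (intro set_integrable_bounded_Icc)
    then have "(LINT s:{0..t}|lborel. r n s) = integral {0..t} (r n)"
      by (rule set_borel_integral_eq_integral)
    also have "\<dots> = euler f X (1 / real (Suc n)) t"
      unfolding r_def using t by (intro integral_unique has_integral_euler_0) auto
    finally show ?thesis .
  qed
  ultimately show ?thesis
    using euler_tendsto[OF t] LIMSEQ_unique by auto
qed

end

section \<open>Growth of the Laplace exponent\<close>

lemma exp_compensated_bounds:
  fixes u :: real
  assumes "0 \<le> u"
  shows "0 \<le> exp (- u) - 1 + u" "exp (- u) - 1 + u \<le> u\<^sup>2"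
proof -
  have nonneg: "0 \<le> exp (- u) - 1 + u" for u :: real
    using exp_ge_add_one_self[of "- u"] by simp
  then show "0 \<le> exp (- u) - 1 + u" .
  \<comment> \<open>The derivative of this difference is the expression whose nonnegativity was just
    shown.\<close>
  have "(\<lambda>u::real. u\<^sup>2 / 2 - (exp (- u) - 1 + u)) 0 \<le> (\<lambda>u. u\<^sup>2 / 2 - (exp (- u) - 1 + u)) u"
  proof (rule DERIV_nonneg_imp_nondecreasing[OF assms])
    fix v :: real
    have "((\<lambda>u. u\<^sup>2 / 2 - (exp (- u) - 1 + u)) has_real_derivative exp (- v) - 1 + v) (at v)"
      by (auto intro!: derivative_eq_intros)
    with nonneg[of v] show "\<exists>y. ((\<lambda>u. u\<^sup>2 / 2 - (exp (- u) - 1 + u)) has_real_derivative y) (at v) \<and> 0 \<le> y"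
      by blast
  qed
  then have "exp (- u) - 1 + u \<le> u\<^sup>2 / 2" by simp
  also have "\<dots> \<le> u\<^sup>2" by simp
  finally show "exp (- u) - 1 + u \<le> u\<^sup>2" .
qed

text \<open>The difference of the two sides vanishes at \<open>0\<close>, and its derivative is
  twice the square of \<open>1 - exp (- v)\<close>. The factor \<open>4\<close> is the one by which
  the Gaussian term of the Laplace exponent scales.\<close>

lemma exp_compensated_doubling:
  fixes u :: real
  assumes "0 \<le> u"
  shows "exp (- (2 * u)) - 1 + 2 * u \<le> 4 * (exp (- u) - 1 + u)"
proof -
  have "(\<lambda>u::real. 4 * (exp (- u) - 1 + u) - (exp (- (2 * u)) - 1 + 2 * u)) 0
     \<le> (\<lambda>u. 4 * (exp (- u) - 1 + u) - (exp (- (2 * u)) - 1 + 2 * u)) u"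
  proof (rule DERIV_nonneg_imp_nondecreasing[OF assms])
    fix v :: real
    have "2 * (1 - exp (- v))\<^sup>2 = 2 + 2 * exp (- (2 * v)) - 4 * exp (- v)"
      by (simp add: power2_eq_square algebra_simps flip: exp_add)
    then have "((\<lambda>u. 4 * (exp (- u) - 1 + u) - (exp (- (2 * u)) - 1 + 2 * u))
        has_real_derivative 2 * (1 - exp (- v))\<^sup>2) (at v)"
      by (auto intro!: derivative_eq_intros)
    then show "\<exists>y. ((\<lambda>u. 4 * (exp (- u) - 1 + u) - (exp (- (2 * u)) - 1 + 2 * u))
        has_real_derivative y) (at v) \<and> 0 \<le> y"
      by (intro exI[of _ "2 * (1 - exp (- v))\<^sup>2"]) simp
  qed
  then show ?thesis by simp
qed

definition compensated_exp :: "real \<Rightarrow> real \<Rightarrow> real" where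
  "compensated_exp \<theta> z = exp (- \<theta> * z) - 1 + \<theta> * z * indicator {0<..<1} z"

lemma laplace_exponent_compensated:
  "laplace_exponent \<gamma> \<sigma> \<nu> \<theta> = \<gamma> * \<theta> + 1 / 2 * \<sigma>\<^sup>2 * \<theta>\<^sup>2 + (LINT z:{0<..}|\<nu>. compensated_exp \<theta> z)"
  by (simp add: laplace_exponent_def compensated_exp_def)

lemma compensated_exp_small:
  assumes "0 < z" "z < 1"
  shows "compensated_exp \<theta> z = exp (- (\<theta> * z)) - 1 + \<theta> * z"
  using assms by (simp add: compensated_exp_def)

lemma compensated_exp_large:
  assumes "1 \<le> z" "0 \<le> \<theta>"
  shows "compensated_exp \<theta> z \<le> 0" "- 1 \<le> compensated_exp \<theta> z"
  using assms by (simp_all add: compensated_exp_def)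

section \<open>Estimates for the Laplace exponent\<close>

context
  fixes \<nu> :: "real measure"
  assumes \<nu>: "levy_measure \<nu>"
begin

lemma sets_levy [measurable_cong, simp]: "sets \<nu> = sets borel"
  using \<nu> by (simp add: levy_measure_def)

lemma levy_integrable_min: "set_integrable \<nu> {0<..} (\<lambda>z. min 1 (z\<^sup>2))"
  unfolding set_integrable_def
proof (rule integrableI_nonneg)
  have "(\<integral>\<^sup>+ z. ennreal (indicator {0<..} z *\<^sub>R min 1 (z\<^sup>2)) \<partial>\<nu>) = (\<integral>\<^sup>+ z\<in>{0<..}. ennreal (min 1 (z\<^sup>2)) \<partial>\<nu>)"
    by (intro nn_integral_cong) (auto simp: indicator_def)
  then show "(\<integral>\<^sup>+ z. ennreal (indicator {0<..} z *\<^sub>R min 1 (z\<^sup>2)) \<partial>\<nu>) < \<infinity>"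
    using \<nu> by (simp add: levy_measure_def)
qed auto

lemma levy_integrable_bound:
  assumes "g \<in> borel_measurable borel" "\<And>z. 0 < z \<Longrightarrow> \<bar>g z\<bar> \<le> C * min 1 (z\<^sup>2)"
  shows "set_integrable \<nu> {0<..} g"
proof -
  have "set_integrable \<nu> {0<..} (\<lambda>z. C * min 1 (z\<^sup>2))"
    using levy_integrable_min by simp
  then show ?thesis
    unfolding set_integrable_def
    by (rule Bochner_Integration.integrable_bound)
       (use assms in \<open>auto simp: indicator_def intro: order.trans[OF _ abs_ge_self]\<close>)
qed

text \<open>Below \<open>1\<close> the compensated integrand is at most quadratic in
  \<open>z\<close>; from \<open>1\<close> on it is bounded by \<open>1\<close>.\<close>

lemma levy_integrable_compensated:
  assumes \<theta>: "0 \<le> \<theta>"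
  shows "set_integrable \<nu> {0<..} (compensated_exp \<theta>)"
proof (rule levy_integrable_bound)
  show "compensated_exp \<theta> \<in> borel_measurable borel"
    unfolding compensated_exp_def by measurable
  fix z :: real assume z: "0 < z"
  show "\<bar>compensated_exp \<theta> z\<bar> \<le> (1 + \<theta>\<^sup>2) * min 1 (z\<^sup>2)"
  proof (cases "z < 1")
    case True
    have "\<bar>compensated_exp \<theta> z\<bar> \<le> (\<theta> * z)\<^sup>2"
      using exp_compensated_bounds[of "\<theta> * z"] z \<theta> True by (simp add: compensated_exp_small)
    also have "\<dots> \<le> (1 + \<theta>\<^sup>2) * z\<^sup>2" by (simp add: power_mult_distrib algebra_simps)
    finally show ?thesis
      using z True by (simp add: min_absorb2 power_le_one)
  next
    case False
    then have "\<bar>compensated_exp \<theta> z\<bar> \<le> 1" using compensated_exp_large[of z \<theta>] \<theta> by auto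
    moreover have "min 1 (z\<^sup>2) = 1"
      using False by (simp add: min_absorb1 one_le_power)
    ultimately show ?thesis
      using zero_le_power2[of \<theta>] by (simp only: mult_1_right)
  qed
qed

lemma levy_integrable_tail:
  assumes "0 < a"
  shows "set_integrable \<nu> {0<..} (indicator {a..} :: real \<Rightarrow> real)"
proof (rule levy_integrable_bound)
  fix z :: real assume z: "0 < z"
  define m where "m = min 1 (a\<^sup>2)"
  have m: "0 < m" using assms by (simp add: m_def)
  have "m \<le> min 1 (z\<^sup>2)" if "a \<le> z"
    using power_mono[OF that, of 2] assms by (auto simp: m_def)
  then show "\<bar>indicator {a..} z :: real\<bar> \<le> (1 / min 1 (a\<^sup>2)) * min 1 (z\<^sup>2)"
    unfolding m_def[symmetric] using m z by (auto simp: indicator_def field_simps)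
qed simp

lemma levy_integrable_middle:
  assumes "0 < a"
  shows "set_integrable \<nu> {0<..} (\<lambda>z. z * indicator {a..<1} z)"
proof -
  have "set_integrable \<nu> {0<..} (indicator {a..} :: real \<Rightarrow> real)"
    using assms by (rule levy_integrable_tail)
  then show ?thesis
    unfolding set_integrable_def
    by (rule Bochner_Integration.integrable_bound) (auto simp: indicator_def)
qed

text \<open>Jumps below \<open>a\<close> have a nonnegative compensated term and are dropped. For
  the others the exponential is bounded below by \<open>0\<close>; the compensator of the jumps in
  \<open>{a..<1}\<close> remains as extra slope, at a cost independent of
  \<open>\<theta>\<close>.\<close>

lemma laplace_exponent_lower_bound:
  assumes a: "0 < a" "a \<le> 1" and \<theta>: "0 \<le> \<theta>"
  shows "(\<gamma> + (LINT z:{0<..}|\<nu>. z * indicator {a..<1} z)) * \<theta> + 1 / 2 * \<sigma>\<^sup>2 * \<theta>\<^sup>2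
      - (LINT z:{0<..}|\<nu>. indicator {a..} z) \<le> laplace_exponent \<gamma> \<sigma> \<nu> \<theta>"
proof -
  note int = levy_integrable_middle[OF a(1)] levy_integrable_tail[OF a(1)]
  have "\<theta> * (LINT z:{0<..}|\<nu>. z * indicator {a..<1} z) - (LINT z:{0<..}|\<nu>. indicator {a..} z)
      = (LINT z:{0<..}|\<nu>. \<theta> * (z * indicator {a..<1} z) - indicator {a..} z)"
    using int by (subst set_integral_diff) auto
  also have "\<dots> \<le> (LINT z:{0<..}|\<nu>. compensated_exp \<theta> z)"
  proof (rule set_integral_mono)
    fix z :: real assume z: "z \<in> {0<..}"
    show "\<theta> * (z * indicator {a..<1} z) - indicator {a..} z \<le> compensated_exp \<theta> z"
    proof (cases "z < 1")
      case True
      then show ?thesis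
        using z \<theta> exp_compensated_bounds(1)[of "\<theta> * z"]
        by (auto simp: compensated_exp_small indicator_def)
    next
      case False
      then show ?thesis
        using z \<theta> a compensated_exp_large(2)[of z \<theta>] by (auto simp: indicator_def)
    qed
  qed (use int levy_integrable_compensated[OF \<theta>] in auto)
  finally show ?thesis
    by (simp add: laplace_exponent_compensated algebra_simps)
qed

text \<open>Controls second exponential moments by first ones. The Gaussian part scales exactly by
  \<open>4\<close>, and jumps below \<open>1\<close> obey the elementary doubling inequality. From
  \<open>1\<close> on the integrand lies between \<open>-1\<close> and \<open>0\<close>, which the
  tail term makes up for. The linear term only doubles, hence
  \<open>- 2 * \<gamma> * \<theta>\<close>.\<close>

lemma laplace_exponent_doubling:
  assumes \<theta>: "0 \<le> \<theta>"
  shows "laplace_exponent \<gamma> \<sigma> \<nu> (2 * \<theta>) \<le>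
    4 * laplace_exponent \<gamma> \<sigma> \<nu> \<theta> - 2 * \<gamma> * \<theta> + 4 * (LINT z:{0<..}|\<nu>. indicator {1..} z)"
proof -
  note int = levy_integrable_compensated[OF \<theta>] levy_integrable_tail[of 1]
  have "(LINT z:{0<..}|\<nu>. compensated_exp (2 * \<theta>) z) \<le>
      (LINT z:{0<..}|\<nu>. 4 * compensated_exp \<theta> z + 4 * indicator {1..} z)"
  proof (rule set_integral_mono)
    fix z :: real assume z: "z \<in> {0<..}"
    show "compensated_exp (2 * \<theta>) z \<le> 4 * compensated_exp \<theta> z + 4 * indicator {1..} z"
    proof (cases "z < 1")
      case True
      then show ?thesis
        using z \<theta> exp_compensated_doubling[of "\<theta> * z"] by (simp add: compensated_exp_small mult.assoc)
    next
      case False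
      then show ?thesis
        using z \<theta> compensated_exp_large[of z \<theta>] compensated_exp_large[of z "2 * \<theta>"] by simp
    qed
  qed (use int levy_integrable_compensated[of "2 * \<theta>"] \<theta> in auto)
  also have "\<dots> = 4 * (LINT z:{0<..}|\<nu>. compensated_exp \<theta> z) + 4 * (LINT z:{0<..}|\<nu>. indicator {1..} z)"
    using int by (subst set_integral_add) auto
  finally show ?thesis
    by (simp add: laplace_exponent_compensated algebra_simps power2_eq_square)
qed

text \<open>Contrapositive of monotone convergence: bounded truncated means would make
  \<open>z\<close> integrable on \<open>{0<..<1}\<close>.\<close>

lemma truncated_mean_unbounded:
  assumes "\<not> set_integrable \<nu> {0<..<1} (\<lambda>z. z)"
  shows "\<exists>n. B < (LINT z:{0<..}|\<nu>. z * indicator {1 / real (Suc n)..<1} z)"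
proof (rule ccontr)
  assume *: "\<not> ?thesis"
  define m where "m n = (LINT z:{0<..}|\<nu>. z * indicator {1 / real (Suc n)..<1} z)" for n
  have sub: "{1 / real (Suc i)..<1} \<subseteq> {1 / real (Suc j)..<1}" if "i \<le> j" for i j
    using that by (auto intro: order.trans[rotated] simp: frac_le)
  have mono: "indicator {0<..} z *\<^sub>R (z * indicator {1 / real (Suc i)..<1} z)
      \<le> indicator {0<..} z *\<^sub>R (z * indicator {1 / real (Suc j)..<1} z)" if "i \<le> j" for i j and z :: real
    using sub[OF that] by (auto simp: indicator_def)
  have int: "integrable \<nu> (\<lambda>z. indicator {0<..} z *\<^sub>R (z * indicator {1 / real (Suc n)..<1} z))" for n
    using levy_integrable_middle[of "1 / real (Suc n)"] by (simp add: set_integrable_def)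
  have "incseq m"
    unfolding m_def set_lebesgue_integral_def
    by (intro incseq_SucI integral_mono int mono) simp
  moreover have "m n \<le> B" for n using * by (simp add: m_def not_less)
  ultimately obtain L where "m \<longlonglongrightarrow> L" using incseq_convergent[of m B] by blast
  have "integrable \<nu> (\<lambda>z. indicator {0<..<1} z *\<^sub>R z)"
  proof (rule integrable_monotone_convergence)
    show "integrable \<nu> (\<lambda>z. indicator {0<..} z *\<^sub>R (z * indicator {1 / real (Suc n)..<1} z))" for n
      by (rule int)
    show "AE z in \<nu>. mono (\<lambda>n. indicator {0<..} z *\<^sub>R (z * indicator {1 / real (Suc n)..<1} z))"
      using mono by (intro always_eventually allI monoI)
    show "AE z in \<nu>. (\<lambda>n. indicator {0<..} z *\<^sub>R (z * indicator {1 / real (Suc n)..<1} z)) \<longlonglongrightarrow> indicator {0<..<1} z *\<^sub>R z"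
    proof (intro always_eventually allI)
      fix z :: real
      show "(\<lambda>n. indicator {0<..} z *\<^sub>R (z * indicator {1 / real (Suc n)..<1} z)) \<longlonglongrightarrow> indicator {0<..<1} z *\<^sub>R z"
      proof (cases "0 < z \<and> z < 1")
        case True
        then have "\<forall>\<^sub>F n in sequentially. inverse (real (Suc n)) < z"
          using LIMSEQ_inverse_real_of_nat by (intro order_tendstoD(2)) auto
        then have "\<forall>\<^sub>F n in sequentially. indicator {0<..} z *\<^sub>R (z * indicator {1 / real (Suc n)..<1} z) = z"
          by eventually_elim (use True in \<open>auto simp: indicator_def inverse_eq_divide\<close>)
        then show ?thesis using True by (simp add: tendsto_eventually)
      next
        case False
        then show ?thesis by (auto simp: indicator_def)
      qed
    qed
    show "(\<lambda>n. \<integral>z. indicator {0<..} z *\<^sub>R (z * indicator {1 / real (Suc n)..<1} z) \<partial>\<nu>) \<longlonglongrightarrow> L"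
      using \<open>m \<longlonglongrightarrow> L\<close> unfolding m_def set_lebesgue_integral_def .
  qed auto
  with assms show False by (simp add: set_integrable_def)
qed

text \<open>When small jumps are summable, the compensator is integrable by itself and moves into
  the linear term, turning \<open>\<gamma>\<close> into the drift.\<close>

lemma laplace_exponent_drift_form:
  assumes int: "set_integrable \<nu> {0<..<1} (\<lambda>z. z)" and \<theta>: "0 \<le> \<theta>"
  shows "set_integrable \<nu> {0<..} (\<lambda>z. exp (- \<theta> * z) - 1)"
    and "laplace_exponent \<gamma> 0 \<nu> \<theta> = levy_drift \<gamma> \<nu> * \<theta> + (LINT z:{0<..}|\<nu>. exp (- \<theta> * z) - 1)"
proof -
  have eq: "indicator {0<..} z *\<^sub>R (z * indicator {0<..<1} z) = indicator {0<..<1} z *\<^sub>R z" for z :: real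
    by (simp add: indicator_def)
  have 1: "set_integrable \<nu> {0<..} (\<lambda>z. z * indicator {0<..<1} z)"
    using int unfolding set_integrable_def eq .
  then have 2: "set_integrable \<nu> {0<..} (\<lambda>z. compensated_exp \<theta> z - \<theta> * (z * indicator {0<..<1} z))"
    using levy_integrable_compensated[OF \<theta>] by (intro set_integral_diff) auto
  have 3: "(\<lambda>z. compensated_exp \<theta> z - \<theta> * (z * indicator {0<..<1} z)) = (\<lambda>z. exp (- \<theta> * z) - 1)"
    by (simp add: compensated_exp_def mult.assoc)
  show 4: "set_integrable \<nu> {0<..} (\<lambda>z. exp (- \<theta> * z) - 1)"
    using 2 unfolding 3 .
  have "(LINT z:{0<..}|\<nu>. exp (- \<theta> * z) - 1) =
      (LINT z:{0<..}|\<nu>. compensated_exp \<theta> z) - \<theta> * (LINT z:{0<..}|\<nu>. z * indicator {0<..<1} z)"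
    unfolding 3[symmetric] using 1 levy_integrable_compensated[OF \<theta>] by (subst set_integral_diff) auto
  moreover have "(LINT z:{0<..}|\<nu>. z * indicator {0<..<1} z) = (LINT z:{0<..<1}|\<nu>. z)"
    unfolding set_lebesgue_integral_def eq ..
  ultimately show "laplace_exponent \<gamma> 0 \<nu> \<theta> = levy_drift \<gamma> \<nu> * \<theta> + (LINT z:{0<..}|\<nu>. exp (- \<theta> * z) - 1)"
    by (simp add: laplace_exponent_compensated levy_drift_def algebra_simps)
qed

text \<open>By the drift form, what remains beside the drift is the integral of
  \<open>(exp (- n * z) - 1) / n\<close>, whose integrand is at most \<open>1 / n\<close> in
  absolute value.\<close>

lemma laplace_exponent_asymptotic_slope:
  assumes int: "set_integrable \<nu> {0<..<1} (\<lambda>z. z)"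
  shows "(\<lambda>n. laplace_exponent \<gamma> 0 \<nu> (real n) / real n) \<longlonglongrightarrow> levy_drift \<gamma> \<nu>"
proof (rule LIMSEQ_imp_Suc)
  define g where "g n z = indicator {0<..} z *\<^sub>R ((exp (- real (Suc n) * z) - 1) / real (Suc n))" for n and z :: real
  \<comment> \<open>A majorant independent of \<open>n\<close>:
    \<open>(1 - exp (- n * z)) / n\<close> is at most \<open>z\<close>, used below \<open>1\<close>,
    and at most \<open>1\<close>, used from \<open>1\<close> on.\<close>
  define w where "w z = indicator {0<..<1} z *\<^sub>R z + indicator {0<..} z *\<^sub>R indicator {1..} z" for z :: real
  have exp_le_1: "exp (- real (Suc n) * z) \<le> 1" if "0 < z" for n z
    using that mult_nonpos_nonneg[of "- real (Suc n)" z] exp_le_cancel_iff[of "- real (Suc n) * z" 0]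
    by (simp del: of_nat_Suc)
  have "(\<lambda>n. integral\<^sup>L \<nu> (g n)) \<longlonglongrightarrow> integral\<^sup>L \<nu> (\<lambda>z. 0)"
  proof (rule integral_dominated_convergence)
    show "integrable \<nu> w"
      unfolding w_def using int levy_integrable_tail[of 1]
      by (intro Bochner_Integration.integrable_add) (auto simp: set_integrable_def)
    show "g n \<in> borel_measurable \<nu>" for n
    proof -
      have "g n \<in> borel_measurable borel" unfolding g_def by simp
      then show ?thesis using measurable_cong_sets[OF sets_levy refl] by blast
    qed
    show "AE z in \<nu>. (\<lambda>n. g n z) \<longlonglongrightarrow> 0"
    proof (rule always_eventually, rule allI, rule tendsto_norm_zero_cancel)
      fix z
      have "norm (g n z) \<le> inverse (real (Suc n))" for n
      proof -
        have "\<bar>exp (- real (Suc n) * z) - 1\<bar> \<le> 1" if "0 < z"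
          using exp_le_1[OF that, of n] exp_gt_zero[of "- real (Suc n) * z"] by linarith
        then have "\<bar>exp (- real (Suc n) * z) - 1\<bar> / real (Suc n) \<le> 1 / real (Suc n)" if "0 < z"
          using that by (intro divide_right_mono) auto
        then show ?thesis by (auto simp: g_def indicator_def inverse_eq_divide)
      qed
      then show "(\<lambda>n. norm (g n z)) \<longlonglongrightarrow> 0"
        by (intro real_tendsto_sandwich[OF _ _ tendsto_const LIMSEQ_inverse_real_of_nat] always_eventually allI norm_ge_zero)
    qed
    show "AE z in \<nu>. norm (g n z) \<le> w z" for n
    proof (intro always_eventually allI)
      fix z :: real
      show "norm (g n z) \<le> w z"
      proof (cases "0 < z")
        case True
        have e: "exp (- real (Suc n) * z) \<le> 1" using True by (rule exp_le_1)
        define N where "N = real (Suc n)"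
        have N: "1 \<le> N" by (simp add: N_def)
        have "norm (g n z) = (1 - exp (- N * z)) / N"
          unfolding g_def N_def using True e by simp
        moreover have "(1 - exp (- N * z)) / N \<le> z"
          using exp_ge_add_one_self[of "- N * z"] N by (simp add: divide_le_eq mult.commute)
        moreover have "(1 - exp (- N * z)) / N \<le> 1"
          using exp_gt_zero[of "- N * z"] N by (simp add: divide_le_eq del: exp_gt_zero)
        ultimately show ?thesis using True by (auto simp: w_def indicator_def)
      qed (auto simp: g_def w_def indicator_def)
    qed
  qed auto
  then have "(\<lambda>n. levy_drift \<gamma> \<nu> + integral\<^sup>L \<nu> (g n)) \<longlonglongrightarrow> levy_drift \<gamma> \<nu>"
    using tendsto_add[OF tendsto_const, of _ 0 sequentially "levy_drift \<gamma> \<nu>"] by simp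
  moreover have "laplace_exponent \<gamma> 0 \<nu> (real (Suc n)) / real (Suc n) = levy_drift \<gamma> \<nu> + integral\<^sup>L \<nu> (g n)" for n
  proof -
    have "integral\<^sup>L \<nu> (g n) = (LINT z:{0<..}|\<nu>. (exp (- real (Suc n) * z) - 1) / real (Suc n))"
      unfolding g_def set_lebesgue_integral_def ..
    also have "\<dots> = (LINT z:{0<..}|\<nu>. exp (- real (Suc n) * z) - 1) / real (Suc n)"
      by (rule set_integral_divide_zero)
    finally show ?thesis
      unfolding laplace_exponent_drift_form(2)[OF int of_nat_0_le_iff] by (simp add: add_divide_distrib del: of_nat_Suc)
  qed
  ultimately show "(\<lambda>n. laplace_exponent \<gamma> 0 \<nu> (real (Suc n)) / real (Suc n)) \<longlonglongrightarrow> levy_drift \<gamma> \<nu>"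
    by simp
qed

lemma laplace_exponent_growth:
  assumes K: "\<sigma> = 0 \<Longrightarrow> set_integrable \<nu> {0<..<1} (\<lambda>z. z) \<Longrightarrow> K < levy_drift \<gamma> \<nu>"
  shows "\<exists>\<epsilon>>0. \<forall>\<^sub>F n in sequentially. \<epsilon> * real n \<le> laplace_exponent \<gamma> \<sigma> \<nu> (real n) - K * real n"
proof (cases "\<sigma> = 0 \<and> set_integrable \<nu> {0<..<1} (\<lambda>z. z)")
  case True
  \<comment> \<open>Half the gap, so that \<open>K + \<epsilon>\<close> stays strictly below the
    limiting slope.\<close>
  define \<epsilon> where "\<epsilon> = (levy_drift \<gamma> \<nu> - K) / 2"
  have \<epsilon>: "0 < \<epsilon>" "K + \<epsilon> < levy_drift \<gamma> \<nu>"
    using True K by (auto simp: \<epsilon>_def field_simps)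
  from True have "\<forall>\<^sub>F n in sequentially. K + \<epsilon> < laplace_exponent \<gamma> 0 \<nu> (real n) / real n"
    using \<epsilon>(2) by (intro order_tendstoD(1)[OF laplace_exponent_asymptotic_slope]) auto
  then have "\<forall>\<^sub>F n in sequentially. \<epsilon> * real n \<le> laplace_exponent \<gamma> \<sigma> \<nu> (real n) - K * real n"
    using eventually_gt_at_top[of 0]
    by eventually_elim (use True in \<open>simp add: field_simps\<close>)
  with \<epsilon> show ?thesis by blast
next
  case False
  \<comment> \<open>Of the surplus \<open>2\<close>, one unit absorbs the constant tail loss
    \<open>C\<close> once \<open>C \<le> real n\<close>; the other remains as the growth rate
    \<open>1\<close>. If \<open>\<sigma> = 0\<close>, the slope comes from a small truncation level
    \<open>a\<close>. Otherwise \<open>a = 1\<close>, for which \<open>{a..<1}\<close> is empty, and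
    the Gaussian term provides it.\<close>
  have "\<exists>a. 0 < a \<and> a \<le> 1 \<and> (\<forall>\<^sub>F n in sequentially. K + 2 \<le>
    \<gamma> + (LINT z:{0<..}|\<nu>. z * indicator {a..<1} z) + 1 / 2 * \<sigma>\<^sup>2 * real n)"
  proof (cases "\<sigma> = 0")
    case True
    with False obtain n where n: "K + 2 - \<gamma> < (LINT z:{0<..}|\<nu>. z * indicator {1 / real (Suc n)..<1} z)"
      using truncated_mean_unbounded by blast
    show ?thesis
    proof (intro exI[of _ "1 / real (Suc n)"] conjI always_eventually allI)
      show "K + 2 \<le> \<gamma> + (LINT z:{0<..}|\<nu>. z * indicator {1 / real (Suc n)..<1} z)
        + 1 / 2 * \<sigma>\<^sup>2 * real k" for k
        using n unfolding True power_zero_numeral by linarith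
    qed simp_all
  next
    case False
    define m where "m = (LINT z:{0<..}|\<nu>. z * indicator {1::real..<1} z)"
    have "\<forall>\<^sub>F n in sequentially. (K + 2 - \<gamma> - m) / (1 / 2 * \<sigma>\<^sup>2) \<le> real n"
      using filterlim_real_sequentially unfolding filterlim_at_top by blast
    then have "\<forall>\<^sub>F n in sequentially. K + 2 \<le> \<gamma> + m + 1 / 2 * \<sigma>\<^sup>2 * real n"
      by eventually_elim (use False in \<open>simp add: field_simps\<close>)
    then show ?thesis by (intro exI[of _ 1]) (simp add: m_def)
  qed
  then obtain a where a: "0 < a" "a \<le> 1" and ev: "\<forall>\<^sub>F n in sequentially. K + 2 \<le>
    \<gamma> + (LINT z:{0<..}|\<nu>. z * indicator {a..<1} z) + 1 / 2 * \<sigma>\<^sup>2 * real n" by blast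
  define C where "C = (LINT z:{0<..}|\<nu>. indicator {a..} z :: real)"
  have "\<forall>\<^sub>F n in sequentially. C \<le> real n"
    using filterlim_real_sequentially by (simp add: filterlim_at_top)
  with ev have "\<forall>\<^sub>F n in sequentially. 1 * real n \<le> laplace_exponent \<gamma> \<sigma> \<nu> (real n) - K * real n"
  proof eventually_elim
    case (elim n)
    have "(K + 2) * real n \<le> (\<gamma> + (LINT z:{0<..}|\<nu>. z * indicator {a..<1} z) + 1 / 2 * \<sigma>\<^sup>2 * real n) * real n"
      using elim(1) by (intro mult_right_mono) auto
    also have "\<dots> \<le> laplace_exponent \<gamma> \<sigma> \<nu> (real n) + C"
      using laplace_exponent_lower_bound[OF a, of "real n" \<gamma> \<sigma>]
      by (simp add: C_def ring_distribs power2_eq_square mult.assoc)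
    finally show ?case using elim(2) by (simp add: ring_distribs)
  qed
  then show ?thesis by (intro exI[of _ 1]) simp
qed

end

section \<open>Increments of the process\<close>

context levy_process
begin

lemma X_measurable: "0 \<le> t \<Longrightarrow> X t \<in> borel_measurable M"
  using adapted subalgebra_F measurable_from_subalg by blast

lemma prob_increment:
  assumes "0 \<le> s" "s \<le> t" "A \<in> sets borel"
  shows "prob {\<omega> \<in> space M. X t \<omega> - X s \<omega> \<in> A} = prob {\<omega> \<in> space M. X (t - s) \<omega> - X 0 \<omega> \<in> A}"
proof -
  have [measurable]: "X t \<in> borel_measurable M" "X s \<in> borel_measurable M"
    "X (t - s) \<in> borel_measurable M" "X 0 \<in> borel_measurable M"
    using assms by (auto intro: X_measurable)
  have "measure (distr M borel (\<lambda>\<omega>. X t \<omega> - X s \<omega>)) A = measure (distr M borel (\<lambda>\<omega>. X (t - s) \<omega> - X 0 \<omega>)) A"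
    using stationary_increments[OF assms(1,2)] by simp
  then show ?thesis
    using assms(3) by (simp add: measure_distr vimage_def Int_def conj_commute)
qed

lemma prob_past_and_increment:
  assumes "0 \<le> s" "s \<le> t" "E \<in> sets (F s)" "A \<in> sets borel"
  shows "prob (E \<inter> {\<omega> \<in> space M. X t \<omega> - X s \<omega> \<in> A}) =
    prob E * prob {\<omega> \<in> space M. X (t - s) \<omega> - X 0 \<omega> \<in> A}"
proof -
  have "{\<omega> \<in> space M. X t \<omega> - X s \<omega> \<in> A} = (\<lambda>\<omega>. X t \<omega> - X s \<omega>) -` A \<inter> space M"
    by auto
  then have "prob (E \<inter> {\<omega> \<in> space M. X t \<omega> - X s \<omega> \<in> A}) =
      prob E * prob {\<omega> \<in> space M. X t \<omega> - X s \<omega> \<in> A}"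
    using assms indep_setD[OF indep_increments[OF assms(1,2)] assms(3)] by blast
  then show ?thesis
    using prob_increment[OF assms(1,2,4)] by simp
qed

end

context spectrally_negative_levy_process
begin

text \<open>Second moments of \<open>exp (n * (X h - X 0 - K * h))\<close>, where \<open>h\<close> is chosen such that the mean is
  \<open>exp 1\<close>; the doubling bound on the Laplace exponent then keeps the second moment bounded.\<close>

lemma increments_exceed_slope:
  assumes K: "\<sigma> = 0 \<Longrightarrow> set_integrable \<nu> {0<..<1} (\<lambda>z. z) \<Longrightarrow> K < levy_drift \<gamma> \<nu>"
  obtains h :: "nat \<Rightarrow> real" and q :: real
  where "q < 1" "\<And>n. 0 < h n" "h \<longlonglongrightarrow> 0"
    "\<And>n. prob {\<omega> \<in> space M. X (h n) \<omega> - X 0 \<omega> \<le> K * h n} \<le> q"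
proof -
  define \<psi> where "\<psi> = laplace_exponent \<gamma> \<sigma> \<nu>"
  define \<phi> where "\<phi> \<theta> = \<psi> \<theta> - K * \<theta>" for \<theta>
  obtain \<epsilon> N where \<epsilon>: "0 < \<epsilon>" and growth: "\<And>n. N \<le> n \<Longrightarrow> \<epsilon> * real n \<le> \<phi> (real n)"
    using laplace_exponent_growth[where \<sigma>=\<sigma> and K=K, OF levy_measure K] by (auto simp: eventually_sequentially \<phi>_def \<psi>_def)
  define C where "C = 4 * (LINT z:{0<..}|\<nu>. indicator {1..} z :: real)"
  \<comment> \<open>Made for \<open>doubling\<close>: for \<open>m \<ge> 1\<close> the remainder of
    the doubling bound is at most
    \<open>(\<bar>2 * K - 2 * \<gamma>\<bar> + \<bar>C\<bar>) * m\<close>, and \<open>m\<close> is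
    at most \<open>\<phi> m / \<epsilon>\<close> by the growth bound.\<close>
  define B where "B = 4 + (\<bar>2 * K - 2 * \<gamma>\<bar> + \<bar>C\<bar>) / \<epsilon>"
  \<comment> \<open>Past the threshold \<open>N\<close> of the growth bound, and at least
    \<open>1\<close>.\<close>
  define k where "k n = Suc (N + n)" for n
  define h where "h n = 1 / \<phi> (real (k n))" for n
  have \<phi>_pos: "0 < \<phi> (real (k n))" and \<phi>_ge: "\<epsilon> * real (k n) \<le> \<phi> (real (k n))" for n
  proof -
    show "\<epsilon> * real (k n) \<le> \<phi> (real (k n))" by (rule growth) (simp add: k_def)
    moreover have "0 < \<epsilon> * real (k n)" using \<epsilon> by (simp add: k_def)
    ultimately show "0 < \<phi> (real (k n))" by linarith
  qed
  have h_pos: "0 < h n" for n using \<phi>_pos by (simp add: h_def)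
  have doubling: "\<phi> (2 * real (k n)) \<le> B * \<phi> (real (k n))" for n
  proof -
    define m where "m = real (k n)"
    have m: "1 \<le> m" by (simp add: m_def k_def)
    define d where "d = \<bar>2 * K - 2 * \<gamma>\<bar> + \<bar>C\<bar>"
    have "\<phi> (2 * m) \<le> 4 * \<phi> m + ((2 * K - 2 * \<gamma>) * m + C)"
      using laplace_exponent_doubling[OF levy_measure, of m \<gamma> \<sigma>] m
      by (simp add: \<phi>_def \<psi>_def C_def algebra_simps)
    moreover have "(2 * K - 2 * \<gamma>) * m + C \<le> d * m"
    proof -
      have "(2 * K - 2 * \<gamma>) * m \<le> \<bar>2 * K - 2 * \<gamma>\<bar> * m"
        using m by (intro mult_right_mono) auto
      moreover have "C \<le> \<bar>C\<bar> * m"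
        using m mult_left_mono[of 1 m "\<bar>C\<bar>"] by linarith
      ultimately show ?thesis unfolding d_def by (simp only: ring_distribs)
    qed
    moreover have "d * m = (d / \<epsilon>) * (\<epsilon> * m)"
      using \<epsilon> by simp
    moreover have "(d / \<epsilon>) * (\<epsilon> * m) \<le> (d / \<epsilon>) * \<phi> m"
      using \<phi>_ge \<epsilon> unfolding m_def d_def by (intro mult_left_mono) auto
    ultimately have "\<phi> (2 * m) \<le> 4 * \<phi> m + (d / \<epsilon>) * \<phi> m"
      by linarith
    also have "\<dots> = B * \<phi> m" by (simp add: B_def d_def ring_distribs)
    finally show ?thesis by (simp only: m_def)
  qed
  show thesis
  proof (rule that[of "1 - exp (- B)" h])
    show "1 - exp (- B) < 1" by simp
    show "0 < h n" for n by (rule h_pos)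
    show "h \<longlonglongrightarrow> 0"
    proof (rule real_tendsto_sandwich)
      show "\<forall>\<^sub>F n in sequentially. 0 \<le> h n" using h_pos by (simp add: less_imp_le)
      have "h n \<le> (1 / \<epsilon>) * inverse (real (Suc n))" for n
      proof -
        have "\<epsilon> * real (Suc n) \<le> \<epsilon> * real (k n)"
          using \<epsilon> by (intro mult_left_mono) (auto simp: k_def)
        also note \<phi>_ge
        finally have "h n \<le> 1 / (\<epsilon> * real (Suc n))"
          unfolding h_def using \<epsilon> \<phi>_pos by (intro divide_left_mono) auto
        also have "\<dots> = (1 / \<epsilon>) * inverse (real (Suc n))"
          by (simp add: inverse_eq_divide del: of_nat_Suc)
        finally show ?thesis .
      qed
      then show "\<forall>\<^sub>F n in sequentially. h n \<le> (1 / \<epsilon>) * inverse (real (Suc n))" by simp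
      show "(\<lambda>n. (1 / \<epsilon>) * inverse (real (Suc n))) \<longlonglongrightarrow> 0"
        using tendsto_mult_left[OF LIMSEQ_inverse_real_of_nat, of "1 / \<epsilon>"] by simp
    qed simp
    fix n
    define t where "t = h n"
    define m where "m = real (k n)"
    have t: "0 < t" and m: "0 \<le> m" and t_eq: "t * \<phi> m = 1"
      using h_pos[of n] \<phi>_pos[of n] by (simp_all add: t_def m_def h_def)
    define W where "W \<omega> = exp (m * (X t \<omega> - X 0 \<omega>) - m * K * t)" for \<omega>
    have [measurable]: "X t \<in> borel_measurable M" "X 0 \<in> borel_measurable M"
      using t by (auto intro: X_measurable)
    define G where "G = {\<omega> \<in> space M. K * t < X t \<omega> - X 0 \<omega>}"
    have [measurable]: "G \<in> sets M" unfolding G_def by measurable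
    have moment: "has_bochner_integral M (\<lambda>\<omega>. exp (\<theta> * (X t \<omega> - X 0 \<omega>) - \<theta> * K * t)) (exp (t * \<phi> \<theta>))"
      if "0 \<le> \<theta>" for \<theta>
    proof -
      have "has_bochner_integral M (\<lambda>\<omega>. exp (- \<theta> * K * t) * exp (\<theta> * (X t \<omega> - X 0 \<omega>)))
          (exp (- \<theta> * K * t) * exp (t * \<psi> \<theta>))"
        unfolding \<psi>_def using that t by (intro has_bochner_integral_mult_right laplace_transform) auto
      also have "exp (- \<theta> * K * t) * exp (t * \<psi> \<theta>) = exp (t * \<phi> \<theta>)"
        unfolding exp_add[symmetric] by (simp add: \<phi>_def algebra_simps)
      finally show ?thesis
        unfolding exp_add[symmetric] by (simp add: algebra_simps)
    qed
    have W1: "has_bochner_integral M W (exp 1)"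
      using moment[OF m] unfolding t_eq W_def .
    have "has_bochner_integral M (\<lambda>\<omega>. (W \<omega>)\<^sup>2) (exp (t * \<phi> (2 * m)))"
    proof -
      have "(\<lambda>\<omega>. (W \<omega>)\<^sup>2) = (\<lambda>\<omega>. exp (2 * m * (X t \<omega> - X 0 \<omega>) - 2 * m * K * t))"
        unfolding W_def by (auto simp: power2_eq_square exp_add[symmetric] algebra_simps)
      then show ?thesis using moment[of "2 * m"] m by simp
    qed
    then have W2: "integrable M (\<lambda>\<omega>. (W \<omega>)\<^sup>2)" "expectation (\<lambda>\<omega>. (W \<omega>)\<^sup>2) = exp (t * \<phi> (2 * m))"
      by (simp_all add: has_bochner_integral_iff)
    have "t * \<phi> (2 * m) \<le> t * (B * \<phi> m)"
      using doubling t unfolding m_def by (intro mult_left_mono) auto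
    also have "\<dots> = B * (t * \<phi> m)" by (simp only: mult_ac)
    finally have W2_le: "expectation (\<lambda>\<omega>. (W \<omega>)\<^sup>2) \<le> exp B"
      unfolding W2(2) t_eq by simp
    \<comment> \<open>On \<open>G\<close> this is the arithmetic-geometric mean inequality with
      weight \<open>exp B\<close>; off \<open>G\<close>, \<open>W \<omega> \<le> 1\<close>. The
      weight makes the mean of the quadratic term at most \<open>1\<close>, so expectations give
      \<open>2 * exp 1 \<le> 3 + exp B * prob G\<close>, and \<open>2 \<le> exp 1\<close> yields
      \<open>exp (- B) \<le> prob G\<close>.\<close>
    have "2 * W \<omega> \<le> 2 + (exp (- B) * (W \<omega>)\<^sup>2 + exp B * indicator G \<omega>)" if "\<omega> \<in> space M" for \<omega>
    proof (cases "\<omega> \<in> G")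
      case True
      have "0 \<le> exp (- B) * (W \<omega> - exp B)\<^sup>2" by simp
      also have "\<dots> = exp (- B) * (W \<omega>)\<^sup>2 - 2 * W \<omega> * (exp (- B) * exp B) + exp B * (exp (- B) * exp B)"
        by (simp add: power2_eq_square algebra_simps)
      also have "exp (- B) * exp B = 1" by (simp flip: exp_add)
      finally show ?thesis using True by simp
    next
      case False
      then have "X t \<omega> - X 0 \<omega> \<le> K * t" using that by (auto simp: G_def)
      then have "m * (X t \<omega> - X 0 \<omega>) \<le> m * (K * t)" using m by (intro mult_left_mono)
      then have "W \<omega> \<le> 1" by (simp add: W_def mult.assoc)
      moreover have "0 \<le> exp (- B) * (W \<omega>)\<^sup>2" by simp
      moreover have "exp B * indicator G \<omega> = 0" using False by simp
      ultimately show ?thesis by linarith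
    qed
    moreover have G_int: "integrable M (indicator G :: 'a \<Rightarrow> real)"
      by (intro integrable_real_indicator) (auto simp: less_top[symmetric])
    ultimately have "expectation (\<lambda>\<omega>. 2 * W \<omega>) \<le> expectation (\<lambda>\<omega>. 2 + (exp (- B) * (W \<omega>)\<^sup>2 + exp B * indicator G \<omega>))"
      using W1 W2(1) G_int by (intro integral_mono Bochner_Integration.integrable_add) (auto simp: has_bochner_integral_iff)
    also have "\<dots> = 2 + (exp (- B) * expectation (\<lambda>\<omega>. (W \<omega>)\<^sup>2) + exp B * prob G)"
      using W2(1) G_int by (simp add: prob_space Bochner_Integration.integrable_add)
    also have "expectation (\<lambda>\<omega>. 2 * W \<omega>) = 2 * exp 1"
      using W1 by (simp add: has_bochner_integral_iff)
    finally have "2 * exp 1 \<le> 2 + (exp (- B) * expectation (\<lambda>\<omega>. (W \<omega>)\<^sup>2) + exp B * prob G)" .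
    moreover have "exp (- B) * expectation (\<lambda>\<omega>. (W \<omega>)\<^sup>2) \<le> exp (- B) * exp B"
      using W2_le by (intro mult_left_mono) auto
    moreover have "exp (- B) * exp B = 1" by (simp flip: exp_add)
    moreover have "2 \<le> exp (1::real)" using exp_ge_add_one_self[of 1] by simp
    ultimately have "1 \<le> exp B * prob G" by linarith
    then have "exp (- B) * 1 \<le> exp (- B) * (exp B * prob G)"
      by (intro mult_left_mono) auto
    also have "\<dots> = prob G"
      using \<open>exp (- B) * exp B = 1\<close> by (simp flip: mult.assoc)
    finally have "exp (- B) \<le> prob G" by simp
    moreover have "prob {\<omega> \<in> space M. X t \<omega> - X 0 \<omega> \<le> K * t} = 1 - prob G"
    proof -
      have "{\<omega> \<in> space M. X t \<omega> - X 0 \<omega> \<le> K * t} = space M - G" by (auto simp: G_def)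
      then show ?thesis by (simp add: prob_compl)
    qed
    ultimately show "prob {\<omega> \<in> space M. X (h n) \<omega> - X 0 \<omega> \<le> K * h n} \<le> 1 - exp (- B)"
      by (simp add: t_def)
  qed
qed

section \<open>Bounded variation without Gaussian part and with summable small jumps\<close>

context
  assumes \<sigma>: "\<sigma> = 0" and small: "set_integrable \<nu> {0<..<1} (\<lambda>z. z)"
begin

text \<open>A Chernoff bound: the jump part of the exponent is nonpositive, so exceeding
  \<open>c * t\<close> by \<open>\<epsilon>\<close> has probability at most
  \<open>exp (- n * \<epsilon>)\<close> for every \<open>n\<close>.\<close>

lemma AE_increment_le_drift_0:
  assumes t: "0 \<le> t"
  shows "AE \<omega> in M. X t \<omega> - X 0 \<omega> \<le> levy_drift \<gamma> \<nu> * t"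
proof -
  define c where "c = levy_drift \<gamma> \<nu>"
  have [measurable]: "X t \<in> borel_measurable M" "X 0 \<in> borel_measurable M"
    using t by (auto intro: X_measurable)
  have bound: "prob {\<omega> \<in> space M. c * t + \<epsilon> \<le> X t \<omega> - X 0 \<omega>} \<le> exp (- real n * \<epsilon>)" for \<epsilon> n
  proof -
    define \<theta> where "\<theta> = real n"
    have \<theta>: "0 \<le> \<theta>" by (simp add: \<theta>_def)
    note L = laplace_transform[OF t \<theta>]
    define Q where "Q = {\<omega> \<in> space M. c * t + \<epsilon> \<le> X t \<omega> - X 0 \<omega>}"
    have [measurable]: "Q \<in> sets M" unfolding Q_def by measurable
    have "exp (\<theta> * (c * t + \<epsilon>)) * prob Q = expectation (\<lambda>\<omega>. exp (\<theta> * (c * t + \<epsilon>)) * indicator Q \<omega>)"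
      by simp
    also have "\<dots> \<le> expectation (\<lambda>\<omega>. exp (\<theta> * (X t \<omega> - X 0 \<omega>)))"
    proof (rule integral_mono)
      fix \<omega> assume "\<omega> \<in> space M"
      then show "exp (\<theta> * (c * t + \<epsilon>)) * indicator Q \<omega> \<le> exp (\<theta> * (X t \<omega> - X 0 \<omega>))"
        using \<theta> by (auto simp: Q_def indicator_def intro: mult_left_mono)
    qed (use L in \<open>auto simp: has_bochner_integral_iff less_top[symmetric] intro!: integrable_real_indicator\<close>)
    also have "\<dots> = exp (t * laplace_exponent \<gamma> 0 \<nu> \<theta>)"
      using L \<sigma> by (simp add: has_bochner_integral_iff)
    also have "\<dots> \<le> exp (t * (c * \<theta>))"
    proof -
      have "(LINT z:{0<..}|\<nu>. exp (- \<theta> * z) - 1) \<le> (LINT z:{0<..}|\<nu>. 0)"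
      proof (rule set_integral_mono)
        show "exp (- \<theta> * z) - 1 \<le> 0" if "z \<in> {0<..}" for z
          using that \<theta> by simp
      qed (use laplace_exponent_drift_form(1)[OF levy_measure small \<theta>] in \<open>auto simp: set_integrable_def\<close>)
      then have "laplace_exponent \<gamma> 0 \<nu> \<theta> \<le> c * \<theta>"
        using laplace_exponent_drift_form(2)[OF levy_measure small \<theta>, of \<gamma>] by (simp add: c_def)
      then show ?thesis using t by (simp add: mult_left_mono)
    qed
    finally have "exp (\<theta> * (c * t + \<epsilon>)) * prob Q \<le> exp (t * (c * \<theta>))" .
    then have "exp (- (\<theta> * (c * t + \<epsilon>))) * (exp (\<theta> * (c * t + \<epsilon>)) * prob Q)
        \<le> exp (- (\<theta> * (c * t + \<epsilon>))) * exp (t * (c * \<theta>))"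
      by (intro mult_left_mono) auto
    then have "prob Q \<le> exp (- (\<theta> * \<epsilon>))"
      unfolding mult.assoc[symmetric] exp_add[symmetric] by (simp add: algebra_simps)
    then show ?thesis by (simp add: Q_def \<theta>_def)
  qed
  have null: "prob {\<omega> \<in> space M. c * t + \<epsilon> \<le> X t \<omega> - X 0 \<omega>} = 0" if \<epsilon>: "0 < \<epsilon>" for \<epsilon>
  proof -
    have "(\<lambda>n. exp (- \<epsilon>) ^ n) \<longlonglongrightarrow> 0"
      using \<epsilon> by (intro LIMSEQ_power_zero) simp
    moreover have "exp (- real n * \<epsilon>) = exp (- \<epsilon>) ^ n" for n
      by (simp flip: exp_of_nat_mult)
    ultimately have "prob {\<omega> \<in> space M. c * t + \<epsilon> \<le> X t \<omega> - X 0 \<omega>} \<le> 0"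
      using bound[of \<epsilon>] by (intro LIMSEQ_le_const[of "\<lambda>n. exp (- \<epsilon>) ^ n"]) (simp_all del: mult_minus_left)
    then show ?thesis using measure_nonneg[of M] by (intro antisym) auto
  qed
  have "AE \<omega> in M. \<forall>n. X t \<omega> - X 0 \<omega> < c * t + 1 / real (Suc n)"
    unfolding AE_all_countable
  proof
    fix n
    have "{\<omega> \<in> space M. c * t + 1 / real (Suc n) \<le> X t \<omega> - X 0 \<omega>} \<in> null_sets M"
      using null[of "1 / real (Suc n)"] by (intro null_setsI) (auto simp: emeasure_eq_measure)
    then show "AE \<omega> in M. X t \<omega> - X 0 \<omega> < c * t + 1 / real (Suc n)"
      by (rule AE_I') auto
  qed
  then show ?thesis
  proof eventually_elim
    case (elim \<omega>)
    have "(\<lambda>n. c * t + 1 / real (Suc n)) \<longlonglongrightarrow> c * t"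
      using tendsto_add[OF tendsto_const LIMSEQ_inverse_real_of_nat, of "c * t"] by (simp add: inverse_eq_divide)
    then show ?case
      using elim unfolding c_def by (intro LIMSEQ_le_const) (auto intro: less_imp_le)
  qed
qed

lemma AE_increment_le_drift:
  assumes "0 \<le> s" "s \<le> t"
  shows "AE \<omega> in M. X t \<omega> - X s \<omega> \<le> levy_drift \<gamma> \<nu> * (t - s)"
proof -
  have [measurable]: "X t \<in> borel_measurable M" "X s \<in> borel_measurable M"
    "X (t - s) \<in> borel_measurable M" "X 0 \<in> borel_measurable M"
    using assms by (auto intro: X_measurable)
  let ?A = "{..levy_drift \<gamma> \<nu> * (t - s)}"
  have "prob {\<omega> \<in> space M. X t \<omega> - X s \<omega> \<in> ?A} = prob {\<omega> \<in> space M. X (t - s) \<omega> - X 0 \<omega> \<in> ?A}"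
    using assms by (intro prob_increment) auto
  also have "\<dots> = 1"
    using AE_increment_le_drift_0[of "t - s"] assms by (subst prob_Collect_eq_1) auto
  finally show ?thesis
    by (subst (asm) prob_Collect_eq_1) auto
qed

text \<open>Links the hypothesis of the theorem, phrased through path variation, to the analytic
  condition in the growth bound. The drift bound on increments holds almost surely at all rational
  times at once and passes to real times by right-continuity.\<close>

lemma bounded_variation_paths_if_small_jumps_summable: "bounded_variation_paths M X"
proof -
  define c where "c = levy_drift \<gamma> \<nu>"
  have "AE \<omega> in M. \<forall>s\<in>\<rat> \<inter> {0..}. \<forall>t\<in>\<rat> \<inter> {0..}. s \<le> t \<longrightarrow> X t \<omega> - X s \<omega> \<le> c * (t - s)"
    using AE_increment_le_drift countable_rat unfolding c_def
    by (intro AE_ball_countable[THEN iffD2] countable_Int1 ballI) auto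
  with cadlag_paths have "AE \<omega> in M. \<forall>s t. 0 \<le> s \<longrightarrow> s \<le> t \<longrightarrow> X t \<omega> - X s \<omega> \<le> c * (t - s)"
  proof eventually_elim
    case (elim \<omega>)
    have lim: "\<exists>r. r \<longlonglongrightarrow> t \<and> (\<forall>n. r n \<in> \<rat> \<inter> {t<..<t + 1}) \<and> (\<lambda>n. X (r n) \<omega>) \<longlonglongrightarrow> X t \<omega>" if t: "0 \<le> t" for t
    proof -
      have "\<exists>r\<in>\<rat>. t < r \<and> r < t + inverse (real (Suc n))" for n
        by (intro Rats_dense_in_real) simp
      then obtain r where r: "\<And>n. r n \<in> \<rat>" "\<And>n. t < r n" "\<And>n. r n < t + inverse (real (Suc n))"
        by metis
      have "r \<longlonglongrightarrow> t"
      proof (rule real_tendsto_sandwich[OF _ _ tendsto_const])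
        show "(\<lambda>n. t + inverse (real (Suc n))) \<longlonglongrightarrow> t"
          using tendsto_add[OF tendsto_const LIMSEQ_inverse_real_of_nat, of t] by simp
      qed (use r(2,3) in \<open>auto intro!: less_imp_le always_eventually simp del: of_nat_Suc\<close>)
      moreover from this have "filterlim r (at_right t) sequentially"
        using r(2) by (intro filterlim_at_withinI always_eventually) (simp_all add: less_imp_neq[symmetric] less_imp_neq[THEN not_sym])
      moreover have "((\<lambda>t. X t \<omega>) \<longlongrightarrow> X t \<omega>) (at_right t)"
        using elim(1) t by (simp add: cadlag_def continuous_within)
      then have "(\<lambda>n. X (r n) \<omega>) \<longlonglongrightarrow> X t \<omega>"
        using \<open>filterlim r (at_right t) sequentially\<close> by (rule filterlim_compose)
      moreover have "r n < t + 1" for n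
      proof -
        have "inverse (real (Suc n)) \<le> 1" by (simp add: inverse_eq_divide)
        with r(3)[of n] show ?thesis by linarith
      qed
      ultimately show ?thesis using r by (intro exI[of _ r]) auto
    qed
    show ?case
    proof (intro allI impI)
      fix s t :: real assume st: "0 \<le> s" "s \<le> t"
      show "X t \<omega> - X s \<omega> \<le> c * (t - s)"
      proof (cases "s = t")
        case False
        \<comment> \<open>Both times are approached by rationals from the right; as
          \<open>s < t\<close>, eventually \<open>a n < t < b n\<close>, so the rational bound
          applies in the right order.\<close>
        obtain a where a: "a \<longlonglongrightarrow> s" "\<And>n. a n \<in> \<rat> \<inter> {s<..<s + 1}" "(\<lambda>n. X (a n) \<omega>) \<longlonglongrightarrow> X s \<omega>"
          using lim[of s] st by blast
        obtain b where b: "b \<longlonglongrightarrow> t" "\<And>n. b n \<in> \<rat> \<inter> {t<..<t + 1}" "(\<lambda>n. X (b n) \<omega>) \<longlonglongrightarrow> X t \<omega>"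
          using lim[of t] st by auto
        have "\<forall>\<^sub>F n in sequentially. a n < t"
          using a(1) False st by (intro order_tendstoD(2)) auto
        then have "\<forall>\<^sub>F n in sequentially. X (b n) \<omega> - X (a n) \<omega> \<le> c * (b n - a n)"
        proof eventually_elim
          case (elim n)
          then show ?case
            using a(2)[of n] b(2)[of n] st \<open>\<forall>s\<in>\<rat> \<inter> {0..}. _\<close> by auto
        qed
        then show ?thesis
          using a b by (intro tendsto_le[OF _ _ _ ]) (auto intro!: tendsto_intros)
      qed simp
    qed
  qed
  then show ?thesis
    unfolding bounded_variation_paths_def
  proof eventually_elim
    case (elim \<omega>)
    show ?case
    proof (intro allI impI)
      fix T :: real assume T: "0 \<le> T"
      \<comment> \<open>Both \<open>2 * \<bar>c\<bar> * t\<close> and \<open>g\<close> are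
        nondecreasing, and their difference is the path; the absolute value covers a drift of either
        sign. Increments of the path are dominated by those of \<open>\<bar>c\<bar> * t + g\<close>,
        whose sum telescopes.\<close>
      define g where "g t = 2 * \<bar>c\<bar> * t - X t \<omega>" for t
      have dom: "\<bar>X t \<omega> - X s \<omega>\<bar> \<le> \<bar>c\<bar> * (t - s) + (g t - g s)" "0 \<le> g t - g s"
        if "0 \<le> s" "s \<le> t" for s t
      proof -
        have 1: "X t \<omega> - X s \<omega> \<le> c * (t - s)" using elim that by blast
        have 2: "c * (t - s) \<le> \<bar>c\<bar> * (t - s)" "0 \<le> \<bar>c\<bar> * (t - s)" 
          using that by (auto intro: mult_right_mono)
        have 3: "g t - g s = 2 * (\<bar>c\<bar> * (t - s)) - (X t \<omega> - X s \<omega>)"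
          by (simp add: g_def algebra_simps)
        show "\<bar>X t \<omega> - X s \<omega>\<bar> \<le> \<bar>c\<bar> * (t - s) + (g t - g s)" "0 \<le> g t - g s"
          using 1 2 3 by linarith+
      qed
      show "bounded_variation_on {0..T} (\<lambda>t. X t \<omega>)"
        unfolding bounded_variation_on_def
      proof (intro exI[of _ "\<bar>c\<bar> * T + (g T - g 0)"] allI impI)
        fix ts :: "real list" assume ts: "sorted ts \<and> set ts \<subseteq> {0..T}"
        show "(\<Sum>i<length ts - 1. \<bar>X (ts ! Suc i) \<omega> - X (ts ! i) \<omega>\<bar>) \<le> \<bar>c\<bar> * T + (g T - g 0)"
        proof (cases "ts = []")
          case True
          then show ?thesis using dom(2)[of 0 T] T by simp
        next
          case False
          define n where "n = length ts - 1"
          have mem: "ts ! i \<in> {0..T}" if "i \<le> n" for i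
          proof -
            have "i < length ts" using that False by (cases ts) (auto simp: n_def)
            then show ?thesis using ts nth_mem by blast
          qed
          have "(\<Sum>i<n. \<bar>X (ts ! Suc i) \<omega> - X (ts ! i) \<omega>\<bar>)
              \<le> (\<Sum>i<n. (\<bar>c\<bar> * (ts ! Suc i) + g (ts ! Suc i)) - (\<bar>c\<bar> * (ts ! i) + g (ts ! i)))"
          proof (rule sum_mono)
            fix i assume i: "i \<in> {..<n}"
            have "ts ! i \<le> ts ! Suc i" using ts i by (intro sorted_nth_mono) (auto simp: n_def)
            with dom(1)[of "ts ! i" "ts ! Suc i"] mem[of i] i
            show "\<bar>X (ts ! Suc i) \<omega> - X (ts ! i) \<omega>\<bar>
              \<le> (\<bar>c\<bar> * (ts ! Suc i) + g (ts ! Suc i)) - (\<bar>c\<bar> * (ts ! i) + g (ts ! i))"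
              by (simp add: algebra_simps)
          qed
          also have "\<dots> = (\<bar>c\<bar> * (ts ! n) + g (ts ! n)) - (\<bar>c\<bar> * (ts ! 0) + g (ts ! 0))"
            by (rule sum_lessThan_telescope)
          also have "\<dots> \<le> \<bar>c\<bar> * T + (g T - g 0)"
          proof -
            have "\<bar>c\<bar> * (ts ! n) \<le> \<bar>c\<bar> * T" "0 \<le> \<bar>c\<bar> * (ts ! 0)"
              using mem[of n] mem[of 0] by (auto intro: mult_left_mono)
            moreover have "g (ts ! n) \<le> g T" "g 0 \<le> g (ts ! 0)"
              using dom(2)[of "ts ! n" T] dom(2)[of 0 "ts ! 0"] mem[of n] mem[of 0] by auto
            ultimately show ?thesis by linarith
          qed
          finally show ?thesis by (simp add: n_def)
        qed
      qed
    qed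
  qed
qed

end

end

section \<open>Time spent at a level\<close>

text \<open>Let \<open>p\<close> be the expected time in \<open>{0..T}\<close> spent at
  \<open>y\<close>. Translating time by \<open>h n\<close> loses at most \<open>h n\<close>. A path
  at \<open>y\<close> at time \<open>s + h n\<close> either was there at \<open>s\<close>, which
  costs the factor \<open>q\<close>, or was not, which has vanishing weight \<open>r (h n)\<close>.
  Hence \<open>p \<le> h n + r (h n) + q * p\<close>.\<close>

lemma (in prob_space) AE_level_set_null_on_Icc:
  fixes Y :: "real \<Rightarrow> 'a \<Rightarrow> real"
  assumes meas: "\<And>t. 0 \<le> t \<Longrightarrow> Y t \<in> borel_measurable M"
    and cont: "\<And>t \<omega>. 0 \<le> t \<Longrightarrow> \<omega> \<in> space M \<Longrightarrow> continuous (at_right t) (\<lambda>t. Y t \<omega>)"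
    and h: "\<And>n. 0 < h n" "h \<longlonglongrightarrow> 0" and q: "q < 1"
    and return: "\<And>n s. 0 \<le> s \<Longrightarrow> prob {\<omega> \<in> space M. Y s \<omega> = y \<and> Y (s + h n) \<omega> = y}
      \<le> q * prob {\<omega> \<in> space M. Y s \<omega> = y}"
    and T: "0 \<le> T"
  shows "AE \<omega> in M. AE s in lborel. s \<in> {0..T} \<longrightarrow> Y s \<omega> \<noteq> y"
proof -
  interpret P: pair_sigma_finite M lborel ..
  define Z where "Z \<omega> t = Y (max 0 t) \<omega>" for \<omega> t
  have Z_eq: "Z \<omega> t = Y t \<omega>" if "0 \<le> t" for \<omega> t using that by (simp add: Z_def)
  have Z [measurable]: "case_prod Z \<in> borel_measurable (M \<Otimes>\<^sub>M borel)"
    using right_continuous_process_measurable[OF meas cont] by (simp add: Z_def case_prod_beta')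
  define I :: "real \<Rightarrow> ennreal" where "I = indicator {0..T}"
  have [measurable]: "I \<in> borel_measurable borel" by (simp add: I_def)
  define A where "A \<omega> s = I s * indicator {y} (Z \<omega> s)" for \<omega> s
  define B where "B d \<omega> s = I s * indicator {y} (Z \<omega> (s + d))" for d \<omega> s
  define D where "D d \<omega> s = I s * (indicator (- {y}) (Z \<omega> s) * indicator {y} (Z \<omega> (s + d)))" for d \<omega> s
  define R where "R d \<omega> s = I s * (indicator {y} (Z \<omega> s) * indicator {y} (Z \<omega> (s + d)))" for d \<omega> s
  have [measurable]: "case_prod A \<in> borel_measurable (M \<Otimes>\<^sub>M borel)" "case_prod (B d) \<in> borel_measurable (M \<Otimes>\<^sub>M borel)"
    "case_prod (D d) \<in> borel_measurable (M \<Otimes>\<^sub>M borel)" "case_prod (R d) \<in> borel_measurable (M \<Otimes>\<^sub>M borel)" for d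
    unfolding A_def B_def D_def R_def by measurable
  have [measurable]: "case_prod A \<in> borel_measurable (M \<Otimes>\<^sub>M lborel)" "case_prod (B d) \<in> borel_measurable (M \<Otimes>\<^sub>M lborel)"
    "case_prod (D d) \<in> borel_measurable (M \<Otimes>\<^sub>M lborel)" "case_prod (R d) \<in> borel_measurable (M \<Otimes>\<^sub>M lborel)" for d
    unfolding measurable_cong_sets[OF sets_pair_measure_cong[OF refl sets_lborel] refl] by measurable
  define p where "p = (\<integral>\<^sup>+\<omega>. \<integral>\<^sup>+s. A \<omega> s \<partial>lborel \<partial>M)"
  define r where "r d = (\<integral>\<^sup>+\<omega>. \<integral>\<^sup>+s. D d \<omega> s \<partial>lborel \<partial>M)" for d
  \<comment> \<open>For \<open>s \<ge> d\<close> in \<open>{0..T}\<close> the time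
    \<open>s - d\<close> is still in \<open>{0..T}\<close>, so only times up to \<open>d\<close>
    escape the translated \<open>B\<close>. The form \<open>- d + 1 * s\<close> fits the affine
    substitution rule.\<close>
  have shift: "(\<integral>\<^sup>+s. A \<omega> s \<partial>lborel) \<le> ennreal d + (\<integral>\<^sup>+s. B d \<omega> s \<partial>lborel)"
    if d: "0 < d" and \<omega>: "\<omega> \<in> space M" for d \<omega>
  proof -
    have Bd: "B d \<omega> \<in> borel_measurable borel"
      using measurable_Pair2[of "case_prod (B d)" M borel borel \<omega>] \<omega> by simp
    have "(\<integral>\<^sup>+s. A \<omega> s \<partial>lborel) \<le> (\<integral>\<^sup>+s. indicator {0..d} s + B d \<omega> (- d + 1 * s) \<partial>lborel)"
      using d by (intro nn_integral_mono) (auto simp: A_def B_def I_def indicator_def)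
    also have "\<dots> = (\<integral>\<^sup>+s. indicator {0..d} s \<partial>lborel) + (\<integral>\<^sup>+s. B d \<omega> (- d + 1 * s) \<partial>lborel)"
    proof (rule nn_integral_add)
      show "(\<lambda>s. B d \<omega> (- d + 1 * s)) \<in> borel_measurable lborel"
        using measurable_compose[OF _ Bd, of "\<lambda>s. - d + 1 * s" borel] by simp
    qed simp
    also have "(\<integral>\<^sup>+s. indicator {0..d} s \<partial>lborel) = ennreal d"
      using d by (simp add: nn_integral_indicator)
    also have "(\<integral>\<^sup>+s. B d \<omega> (- d + 1 * s) \<partial>lborel) = (\<integral>\<^sup>+s. B d \<omega> s \<partial>lborel)"
      using nn_integral_real_affine[OF Bd, of 1 "- d"] by simp
    finally show ?thesis .
  qed
  have split: "(\<integral>\<^sup>+s. B d \<omega> s \<partial>lborel) \<le> (\<integral>\<^sup>+s. D d \<omega> s \<partial>lborel) + (\<integral>\<^sup>+s. R d \<omega> s \<partial>lborel)"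
    if \<omega>: "\<omega> \<in> space M" for d \<omega>
  proof -
    have "D d \<omega> \<in> borel_measurable borel" "R d \<omega> \<in> borel_measurable borel"
      using measurable_Pair2[of "case_prod (D d)" M borel borel \<omega>]
        measurable_Pair2[of "case_prod (R d)" M borel borel \<omega>] \<omega> by simp_all
    then have "(\<integral>\<^sup>+s. D d \<omega> s \<partial>lborel) + (\<integral>\<^sup>+s. R d \<omega> s \<partial>lborel) = (\<integral>\<^sup>+s. D d \<omega> s + R d \<omega> s \<partial>lborel)"
      by (intro nn_integral_add[symmetric]) auto
    moreover have "(\<integral>\<^sup>+s. B d \<omega> s \<partial>lborel) \<le> (\<integral>\<^sup>+s. D d \<omega> s + R d \<omega> s \<partial>lborel)"
      by (intro nn_integral_mono) (auto simp: B_def D_def R_def indicator_def)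
    ultimately show ?thesis by simp
  qed
  \<comment> \<open>Fubini brings the expectation inside, where the return bound applies at each
    fixed \<open>s\<close>.\<close>
  have R_le: "(\<integral>\<^sup>+\<omega>. \<integral>\<^sup>+s. R (h n) \<omega> s \<partial>lborel \<partial>M) \<le> ennreal q * p" for n
  proof -
    have "(\<integral>\<^sup>+\<omega>. \<integral>\<^sup>+s. R (h n) \<omega> s \<partial>lborel \<partial>M) = (\<integral>\<^sup>+s. \<integral>\<^sup>+\<omega>. R (h n) \<omega> s \<partial>M \<partial>lborel)"
      by (rule P.Fubini'[symmetric]) measurable
    also have "\<dots> \<le> (\<integral>\<^sup>+s. ennreal q * (\<integral>\<^sup>+\<omega>. A \<omega> s \<partial>M) \<partial>lborel)"
    proof (rule nn_integral_mono)
      fix s :: real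
      show "(\<integral>\<^sup>+\<omega>. R (h n) \<omega> s \<partial>M) \<le> ennreal q * (\<integral>\<^sup>+\<omega>. A \<omega> s \<partial>M)"
      proof (cases "s \<in> {0..T}")
        case True
        then have s: "0 \<le> s" "0 \<le> s + h n" using h(1)[of n] by auto
        have [measurable]: "Y s \<in> borel_measurable M" "Y (s + h n) \<in> borel_measurable M"
          using s meas by auto
        have "(\<integral>\<^sup>+\<omega>. R (h n) \<omega> s \<partial>M) = (\<integral>\<^sup>+\<omega>. indicator {\<omega> \<in> space M. Y s \<omega> = y \<and> Y (s + h n) \<omega> = y} \<omega> \<partial>M)"
          using True s by (intro nn_integral_cong) (auto simp: R_def I_def indicator_def Z_eq)
        also have "\<dots> = ennreal (prob {\<omega> \<in> space M. Y s \<omega> = y \<and> Y (s + h n) \<omega> = y})"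
          by (simp add: emeasure_eq_measure)
        also have "\<dots> \<le> ennreal (q * prob {\<omega> \<in> space M. Y s \<omega> = y})"
          using return[OF s(1), of n] by (rule ennreal_leI)
        also have "\<dots> = ennreal q * ennreal (prob {\<omega> \<in> space M. Y s \<omega> = y})"
          by (simp add: ennreal_mult'')
        also have "ennreal (prob {\<omega> \<in> space M. Y s \<omega> = y}) = (\<integral>\<^sup>+\<omega>. indicator {\<omega> \<in> space M. Y s \<omega> = y} \<omega> \<partial>M)"
          by (simp add: emeasure_eq_measure)
        also have "\<dots> = (\<integral>\<^sup>+\<omega>. A \<omega> s \<partial>M)"
          using True s by (intro nn_integral_cong) (auto simp: A_def I_def indicator_def Z_eq)
        finally show ?thesis .
      qed (simp add: R_def I_def)
    qed
    also have "\<dots> = ennreal q * (\<integral>\<^sup>+s. \<integral>\<^sup>+\<omega>. A \<omega> s \<partial>M \<partial>lborel)"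
      by (rule nn_integral_cmult) measurable
    also have "(\<integral>\<^sup>+s. \<integral>\<^sup>+\<omega>. A \<omega> s \<partial>M \<partial>lborel) = p"
      unfolding p_def by (rule P.Fubini') measurable
    finally show ?thesis .
  qed
  have p_le: "p \<le> ennreal (h n) + (r (h n) + ennreal q * p)" for n
  proof -
    have "p \<le> (\<integral>\<^sup>+\<omega>. ennreal (h n) + ((\<integral>\<^sup>+s. D (h n) \<omega> s \<partial>lborel) + (\<integral>\<^sup>+s. R (h n) \<omega> s \<partial>lborel)) \<partial>M)"
      unfolding p_def
    proof (rule nn_integral_mono)
      fix \<omega> assume "\<omega> \<in> space M"
      from shift[OF h(1)[of n] this] split[OF this, of "h n"]
      show "(\<integral>\<^sup>+s. A \<omega> s \<partial>lborel) \<le> ennreal (h n) + ((\<integral>\<^sup>+s. D (h n) \<omega> s \<partial>lborel) + (\<integral>\<^sup>+s. R (h n) \<omega> s \<partial>lborel))"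
        by (meson add_left_mono order.trans)
    qed
    also have "\<dots> = ennreal (h n) + (r (h n) + (\<integral>\<^sup>+\<omega>. \<integral>\<^sup>+s. R (h n) \<omega> s \<partial>lborel \<partial>M))"
      by (simp add: nn_integral_add r_def emeasure_space_1)
    also have "\<dots> \<le> ennreal (h n) + (r (h n) + ennreal q * p)"
      using R_le by (intro add_left_mono)
    finally show ?thesis .
  qed
  have total: "(\<integral>\<^sup>+\<omega>. \<integral>\<^sup>+s. I s \<partial>lborel \<partial>M) = ennreal T"
    using T by (simp add: I_def emeasure_space_1)
  \<comment> \<open>A path not at \<open>y\<close> at time \<open>s\<close> is, by right-continuity,
    not at \<open>y\<close> at time \<open>s + h n\<close> for large \<open>n\<close>, so
    \<open>D\<close> tends to \<open>0\<close> pointwise.\<close>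
  have r_lim: "(\<lambda>n. r (h n)) \<longlonglongrightarrow> 0"
  proof -
    have "(\<lambda>n. \<integral>\<^sup>+z. case_prod (D (h n)) z \<partial>(M \<Otimes>\<^sub>M lborel)) \<longlonglongrightarrow> (\<integral>\<^sup>+(z :: 'a \<times> real). 0 \<partial>(M \<Otimes>\<^sub>M lborel))"
    proof (rule nn_integral_dominated_convergence[where u="\<lambda>n. case_prod (D (h n))"
          and u'="\<lambda>_. 0" and w="\<lambda>z. I (snd z)"])
      have I_snd: "(\<lambda>z. I (snd z)) \<in> borel_measurable (M \<Otimes>\<^sub>M lborel)"
        by (rule measurable_compose[OF measurable_snd]) (simp add: I_def)
      then show "(\<lambda>z. I (snd z)) \<in> borel_measurable (M \<Otimes>\<^sub>M lborel)" .
      have "(\<integral>\<^sup>+z. I (snd z) \<partial>(M \<Otimes>\<^sub>M lborel)) = ennreal T"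
        unfolding total[symmetric] using lborel.nn_integral_fst[OF I_snd] by simp
      then show "(\<integral>\<^sup>+z. I (snd z) \<partial>(M \<Otimes>\<^sub>M lborel)) < \<infinity>" by simp
      show "AE z in M \<Otimes>\<^sub>M lborel. case_prod (D (h n)) z \<le> I (snd z)" for n
        by (intro AE_I2) (auto simp: D_def indicator_def)
      show "AE z in M \<Otimes>\<^sub>M lborel. (\<lambda>n. case_prod (D (h n)) z) \<longlonglongrightarrow> 0"
      proof (rule AE_I2)
        fix z assume "z \<in> space (M \<Otimes>\<^sub>M (lborel :: real measure))"
        then obtain \<omega> s where z: "z = (\<omega>, s)" and \<omega>: "\<omega> \<in> space M"
          by (auto simp: space_pair_measure)
        show "(\<lambda>n. case_prod (D (h n)) z) \<longlonglongrightarrow> 0"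
        proof (cases "0 \<le> s \<and> Y s \<omega> \<noteq> y")
          case True
          then have s: "0 \<le> s" by simp
          have "((\<lambda>t. Y t \<omega>) \<longlongrightarrow> Y s \<omega>) (at_right s)"
            using cont[OF s \<omega>] by (simp add: continuous_within)
          moreover have "filterlim (\<lambda>n. s + h n) (at_right s) sequentially"
          proof (rule filterlim_at_withinI)
            show "(\<lambda>n. s + h n) \<longlonglongrightarrow> s"
              using tendsto_add[OF tendsto_const h(2), of s] by simp
            show "\<forall>\<^sub>F n in sequentially. s + h n \<in> {s<..} - {s}"
              using h(1) by (simp add: less_imp_neq[THEN not_sym])
          qed
          ultimately have "(\<lambda>n. Y (s + h n) \<omega>) \<longlonglongrightarrow> Y s \<omega>"
            by (rule filterlim_compose)
          then have "\<forall>\<^sub>F n in sequentially. Y (s + h n) \<omega> \<noteq> y"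
            using True by (intro tendsto_imp_eventually_ne) auto
          then have "\<forall>\<^sub>F n in sequentially. case_prod (D (h n)) z = 0"
            by eventually_elim (use s h(1) in \<open>auto simp: D_def z Z_eq add_nonneg_pos less_imp_le\<close>)
          then show ?thesis by (rule tendsto_eventually)
        next
          case False
          then have "case_prod (D (h n)) z = 0" for n
            by (cases "0 \<le> s") (auto simp: D_def z Z_eq I_def)
          then show ?thesis by simp
        qed
      qed
    qed measurable
    moreover have "(\<integral>\<^sup>+z. case_prod (D (h n)) z \<partial>(M \<Otimes>\<^sub>M lborel)) = r (h n)" for n
      unfolding r_def by (subst lborel.nn_integral_fst[symmetric]) simp_all
    ultimately show ?thesis by simp
  qed
  have "p \<le> ennreal q * p"
  proof (rule LIMSEQ_le_const)
    have "(\<lambda>n. ennreal (h n)) \<longlonglongrightarrow> ennreal 0"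
      using h(2) by (intro tendsto_ennrealI)
    from tendsto_add[OF this tendsto_add[OF r_lim tendsto_const[of "ennreal q * p"]]]
    show "(\<lambda>n. ennreal (h n) + (r (h n) + ennreal q * p)) \<longlonglongrightarrow> ennreal q * p" by simp
  qed (use p_le in auto)
  \<comment> \<open>Finiteness of \<open>p\<close> is what lets \<open>p \<le> q * p\<close> with
    \<open>q < 1\<close> force \<open>p = 0\<close>.\<close>
  moreover have "p \<le> ennreal T"
    unfolding p_def total[symmetric] by (intro nn_integral_mono) (auto simp: A_def indicator_def)
  ultimately have "p = 0"
  proof (cases p)
    case (real x)
    with \<open>p \<le> ennreal q * p\<close> have "ennreal x \<le> ennreal (q * x)"
      by (simp add: ennreal_mult'')
    then have "x \<le> 0 \<or> x \<le> q * x" by (auto simp: ennreal_le_iff2)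
    moreover have "q * x < 1 * x" if "0 < x" using q that by (intro mult_strict_right_mono)
    ultimately show ?thesis using real by (cases "x = 0") auto
  next
    case top
    with \<open>p \<le> ennreal T\<close> have "(\<top> :: ennreal) \<le> ennreal T" by simp
    then show ?thesis by (simp add: top_unique)
  qed
  then have "AE \<omega> in M. (\<integral>\<^sup>+s. A \<omega> s \<partial>lborel) = 0"
    unfolding p_def by (subst (asm) nn_integral_0_iff_AE) measurable
  with AE_space show ?thesis
  proof eventually_elim
    case (elim \<omega>)
    have "A \<omega> \<in> borel_measurable lborel"
      using measurable_Pair2[of "case_prod A" M borel borel \<omega>] elim(1) by simp
    then have "AE s in lborel. A \<omega> s = 0"
      using elim(2) by (simp add: nn_integral_0_iff_AE)
    then show "AE s in lborel. s \<in> {0..T} \<longrightarrow> Y s \<omega> \<noteq> y"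
      by eventually_elim (auto simp: A_def I_def Z_eq)
  qed
qed

lemma (in prob_space) AE_level_set_null:
  fixes Y :: "real \<Rightarrow> 'a \<Rightarrow> real"
  assumes meas: "\<And>t. 0 \<le> t \<Longrightarrow> Y t \<in> borel_measurable M"
    and cont: "\<And>t \<omega>. 0 \<le> t \<Longrightarrow> \<omega> \<in> space M \<Longrightarrow> continuous (at_right t) (\<lambda>t. Y t \<omega>)"
    and h: "\<And>n. 0 < h n" "h \<longlonglongrightarrow> 0" and q: "q < 1"
    and return: "\<And>n s. 0 \<le> s \<Longrightarrow> prob {\<omega> \<in> space M. Y s \<omega> = y \<and> Y (s + h n) \<omega> = y}
      \<le> q * prob {\<omega> \<in> space M. Y s \<omega> = y}"
  shows "AE \<omega> in M. AE s in lborel. 0 \<le> s \<longrightarrow> Y s \<omega> \<noteq> y"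
proof -
  have "AE \<omega> in M. \<forall>m. AE s in lborel. s \<in> {0..real m} \<longrightarrow> Y s \<omega> \<noteq> y"
    unfolding AE_all_countable using AE_level_set_null_on_Icc[OF assms] by simp
  then show ?thesis
  proof eventually_elim
    case (elim \<omega>)
    then have "AE s in lborel. \<forall>m. s \<in> {0..real m} \<longrightarrow> Y s \<omega> \<noteq> y"
      by (subst AE_all_countable)
    then show ?case
      by eventually_elim (use real_arch_simple in auto)
  qed
qed

section \<open>Adaptedness and existence of the solution\<close>

lemma space_natural_filtration: "space (natural_filtration M X t) = space M"
  unfolding natural_filtration_def by (rule space_measure_of) auto

lemma sets_natural_filtration:
  "sets (natural_filtration M X t) =
     sigma_sets (space M) (\<Union>s\<in>{0..t}. {X s -` A \<inter> space M | A. A \<in> sets borel})"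
  unfolding natural_filtration_def by (rule sets_measure_of) auto

lemma (in levy_process) natural_filtration_measurable:
  assumes "0 \<le> s" "s \<le> t"
  shows "X s \<in> borel_measurable (natural_filtration M X t)"
proof (rule measurableI)
  fix A :: "real set" assume "A \<in> sets borel"
  then have "X s -` A \<inter> space M \<in> (\<Union>s\<in>{0..t}. {X s -` A \<inter> space M | A. A \<in> sets borel})"
    using assms by (intro UN_I[of s]) auto
  then show "X s -` A \<inter> space (natural_filtration M X t) \<in> sets (natural_filtration M X t)"
    unfolding space_natural_filtration sets_natural_filtration by (rule sigma_sets.Basic)
qed simp

text \<open>Carries events of the natural filtration over to \<open>F t\<close>, from which later
  increments are independent.\<close>

lemma (in levy_process) natural_filtration_subset:
  assumes "0 \<le> t"
  shows "sets (natural_filtration M X t) \<subseteq> sets (F t)"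
proof -
  have space: "space (F t) = space M" using subalgebra_F[OF assms] by (simp add: subalgebra_def)
  have "X s -` A \<inter> space M \<in> sets (F t)" if "0 \<le> s" "s \<le> t" "A \<in> sets borel" for s A
  proof -
    have "X s -` A \<inter> space (F s) \<in> sets (F s)"
      using adapted[OF that(1)] that(3) by (rule measurable_sets)
    moreover have "space (F s) = space M" using subalgebra_F[OF that(1)] by (simp add: subalgebra_def)
    ultimately show ?thesis using sets_F_mono[OF that(1,2)] by auto
  qed
  then show ?thesis
    unfolding sets_natural_filtration space[symmetric] by (intro sets.sigma_sets_subset) auto
qed

lemma (in levy_process) euler_node_adapted:
  assumes f: "f \<in> borel_measurable borel" and e: "0 < e"
  shows "real j * e \<le> t \<Longrightarrow> (\<lambda>\<omega>. euler_node f (\<lambda>s. X s \<omega>) e j) \<in> borel_measurable (natural_filtration M X t)"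
proof (induction j)
  case (Suc j)
  have "real j * e \<le> t" using Suc.prems e by (simp add: ring_distribs)
  note [measurable] = Suc.IH[OF this] f natural_filtration_measurable[of "real j * e" t, OF _ this]
  have [measurable]: "X (real j * e) \<in> borel_measurable (natural_filtration M X t)"
    using \<open>real j * e \<le> t\<close> e by (intro natural_filtration_measurable) auto
  show ?case unfolding euler_node.simps by measurable
qed simp

text \<open>Each polygon at \<open>t\<close> uses path values at grid times up to \<open>t\<close>
  only, and \<open>lim\<close> preserves measurability whether or not the sequence
  converges.\<close>

lemma (in levy_process) euler_limit_adapted:
  assumes f: "f \<in> borel_measurable borel" and t: "0 \<le> t"
  shows "(\<lambda>\<omega>. euler_limit f (\<lambda>s. X s \<omega>) t) \<in> borel_measurable (natural_filtration M X t)"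
proof -
  have "(\<lambda>\<omega>. euler f (\<lambda>s. X s \<omega>) e t) \<in> borel_measurable (natural_filtration M X t)" if e: "0 < e" for e
  proof -
    have le: "real (cell e t) * e \<le> t" using cell_bounds[OF e t] by simp
    have [measurable]: "X (real (cell e t) * e) \<in> borel_measurable (natural_filtration M X t)"
      using le e by (intro natural_filtration_measurable) auto
    note [measurable] = f euler_node_adapted[OF f e le]
    show ?thesis unfolding euler_def euler_arg_def by measurable
  qed
  then show ?thesis
    unfolding euler_limit_def by (intro borel_measurable_lim_metric) simp
qed


section \<open>Avoiding the discontinuities of the step function\<close>

lemma isCont_step_sum:
  fixes \<delta> b :: "nat \<Rightarrow> real"
  assumes "\<And>i. i \<in> I \<Longrightarrow> u \<noteq> b i"
  shows "isCont (\<lambda>u. \<Sum>i\<in>I. \<delta> i * indicator {b i<..} u) u"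
  using assms by (intro continuous_intros) (auto simp: isCont_indicator)

lemma (in prob_space) prob_mono_AE:
  assumes "AE \<omega> in M. P \<omega> \<longrightarrow> Q \<omega>" "{\<omega> \<in> space M. Q \<omega>} \<in> sets M"
  shows "prob {\<omega> \<in> space M. P \<omega>} \<le> prob {\<omega> \<in> space M. Q \<omega>}"
  using assms by (intro finite_measure_mono_AE) auto

text \<open>If the solution is at \<open>y\<close> at times \<open>s\<close> and
  \<open>s + h n\<close>, the increment of \<open>X\<close> equals that of
  \<open>euler_limit\<close> and is at most \<open>K * h n\<close>. The event of so small an
  increment is independent of \<open>F s\<close>, so \<open>slope\<close> yields the factor
  \<open>q\<close> for \<open>AE_level_set_null\<close>.\<close>

lemma (in levy_process) AE_euler_solution_avoids_level:
  assumes f: "\<And>u. 0 \<le> f u" "\<And>u. f u \<le> K" "mono f"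
    and h: "\<And>n. 0 < h n" "h \<longlonglongrightarrow> 0" and q: "q < 1"
    and slope: "\<And>n. prob {\<omega> \<in> space M. X (h n) \<omega> - X 0 \<omega> \<le> K * h n} \<le> q"
  shows "AE \<omega> in M. AE s in lborel. 0 \<le> s \<longrightarrow> X s \<omega> - euler_limit f (\<lambda>t. X t \<omega>) s \<noteq> y"
proof -
  define U where "U s \<omega> = X s \<omega> - euler_limit f (\<lambda>t. X t \<omega>) s" for s \<omega>
  have f_meas: "f \<in> borel_measurable borel" using f(3) by (rule borel_measurable_mono)
  have U_adapted: "U s \<in> borel_measurable (natural_filtration M X s)" if "0 \<le> s" for s
    unfolding U_def using that
    by (intro borel_measurable_diff natural_filtration_measurable euler_limit_adapted f_meas) auto
  have U_F: "{\<omega> \<in> space M. U s \<omega> = y} \<in> sets (F s)" if "0 \<le> s" for s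
  proof -
    have "U s -` {y} \<inter> space (natural_filtration M X s) \<in> sets (natural_filtration M X s)"
      using U_adapted[OF that] by (rule measurable_sets) simp
    also have "U s -` {y} \<inter> space (natural_filtration M X s) = {\<omega> \<in> space M. U s \<omega> = y}"
      by (auto simp: space_natural_filtration)
    finally show ?thesis using natural_filtration_subset[OF that] by blast
  qed
  have U_meas: "U s \<in> borel_measurable M" if "0 \<le> s" for s
  proof (rule measurableI)
    fix A :: "real set" assume "A \<in> sets borel"
    then have "U s -` A \<inter> space (natural_filtration M X s) \<in> sets (natural_filtration M X s)"
      using U_adapted[OF that] by (intro measurable_sets)
    then show "U s -` A \<inter> space M \<in> sets M"
      using natural_filtration_subset[OF that] subalgebra_F[OF that]
      by (auto simp: space_natural_filtration subalgebra_def)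
  qed simp
  obtain N where N: "{\<omega> \<in> space M. \<not> cadlag (\<lambda>t. X t \<omega>)} \<subseteq> N" "emeasure M N = 0" "N \<in> sets M"
    using cadlag_paths by (rule AE_E)
  note [measurable] = N(3)
  define Y where "Y s \<omega> = (if \<omega> \<in> N then 0 else U s \<omega>)" for s \<omega>
  have AE_N: "AE \<omega> in M. \<omega> \<notin> N"
    using N by (intro AE_not_in) auto
  have "AE \<omega> in M. AE s in lborel. 0 \<le> s \<longrightarrow> Y s \<omega> \<noteq> y"
  proof (rule AE_level_set_null[OF _ _ h q])
    show Y_meas: "Y t \<in> borel_measurable M" if "0 \<le> t" for t
      unfolding Y_def using U_meas[OF that] by measurable
    show "continuous (at_right t) (\<lambda>t. Y t \<omega>)" if "0 \<le> t" "\<omega> \<in> space M" for t \<omega>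
    proof (cases "\<omega> \<in> N")
      case False
      with that N(1) have "cadlag (\<lambda>t. X t \<omega>)" by blast
      from right_continuous_solution[OF this f that(1)] False show ?thesis
        by (simp add: Y_def U_def)
    qed (simp add: Y_def)
    fix n and s :: real assume s: "0 \<le> s"
    have sh: "0 \<le> s + h n" "s \<le> s + h n" using s h(1)[of n] by auto
    have [measurable]: "X (s + h n) \<in> borel_measurable M" "X s \<in> borel_measurable M" "U s \<in> borel_measurable M"
      "Y s \<in> borel_measurable M"
      using s sh X_measurable U_meas Y_meas by auto
    let ?E = "{\<omega> \<in> space M. U s \<omega> = y}"
    let ?I = "{\<omega> \<in> space M. X (s + h n) \<omega> - X s \<omega> \<in> {..K * h n}}"
    have "prob {\<omega> \<in> space M. Y s \<omega> = y \<and> Y (s + h n) \<omega> = y}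
        \<le> prob {\<omega> \<in> space M. U s \<omega> = y \<and> X (s + h n) \<omega> - X s \<omega> \<in> {..K * h n}}"
    proof (rule prob_mono_AE)
      show "AE \<omega> in M. Y s \<omega> = y \<and> Y (s + h n) \<omega> = y \<longrightarrow> U s \<omega> = y \<and> X (s + h n) \<omega> - X s \<omega> \<in> {..K * h n}"
        using AE_N cadlag_paths
      proof eventually_elim
        case (elim \<omega>)
        from euler_limit_increment(2)[OF elim(2) f s sh(2)] elim(1) show ?case
          by (auto simp: Y_def U_def)
      qed
    qed measurable
    also have "{\<omega> \<in> space M. U s \<omega> = y \<and> X (s + h n) \<omega> - X s \<omega> \<in> {..K * h n}} = ?E \<inter> ?I" by auto
    also have "prob (?E \<inter> ?I) = prob ?E * prob {\<omega> \<in> space M. X (s + h n - s) \<omega> - X 0 \<omega> \<in> {..K * h n}}"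
      using s sh U_F by (intro prob_past_and_increment) auto
    also have "\<dots> \<le> prob ?E * q"
      using slope[of n] by (intro mult_left_mono) auto
    also have "\<dots> \<le> prob {\<omega> \<in> space M. Y s \<omega> = y} * q"
    proof (intro mult_right_mono prob_mono_AE)
      show "0 \<le> q" using order.trans[OF measure_nonneg slope[of n]] .
      show "AE \<omega> in M. U s \<omega> = y \<longrightarrow> Y s \<omega> = y"
        using AE_N by eventually_elim (simp add: Y_def)
    qed measurable
    finally show "prob {\<omega> \<in> space M. Y s \<omega> = y \<and> Y (s + h n) \<omega> = y} \<le> q * prob {\<omega> \<in> space M. Y s \<omega> = y}"
      by (simp only: mult.commute)
  qed
  with AE_N show ?thesis
    by eventually_elim (simp add: Y_def U_def)
qed

theorem theorem1:
  fixes M :: "'a measure" and F :: "real \<Rightarrow> 'a measure"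
    and X :: "real \<Rightarrow> 'a \<Rightarrow> real" and x \<gamma> \<sigma> :: real and \<nu> :: "real measure"
    and k :: nat and \<delta> b :: "nat \<Rightarrow> real"
  assumes "spectrally_negative_levy_process M F X x \<gamma> \<sigma> \<nu>"
    and "\<not> monotone_paths M X"
    and "1 \<le> k"
    and "\<And>i. i \<in> {1..k} \<Longrightarrow> 0 < \<delta> i"
    and "strict_mono_on {1..k} b"
    and "bounded_variation_paths M X \<Longrightarrow> (\<Sum>i=1..k. \<delta> i) < levy_drift \<gamma> \<nu>"
  shows "\<exists>U. strong_solution M X k \<delta> b U"
proof -
  interpret spectrally_negative_levy_process M F X x \<gamma> \<sigma> \<nu> by fact
  define K where "K = (\<Sum>i=1..k. \<delta> i)"
  define f where "f u = (\<Sum>i=1..k. \<delta> i * indicator {b i<..} u)" for u :: real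
  have \<delta>: "0 \<le> \<delta> i" if "i \<in> {1..k}" for i using assms(4)[OF that] by simp
  have f: "0 \<le> f u" "f u \<le> K" for u
  proof -
    show "0 \<le> f u" unfolding f_def using \<delta> by (intro sum_nonneg) simp
    show "f u \<le> K"
      unfolding f_def K_def by (intro sum_mono) (use \<delta> in \<open>auto simp: indicator_def\<close>)
  qed
  have f_cont: "isCont f u" if "\<And>i. i \<in> {1..k} \<Longrightarrow> u \<noteq> b i" for u
    unfolding f_def[abs_def] using that by (rule isCont_step_sum)
  have f_mono: "mono f"
  proof (rule monoI)
    fix u v :: real assume "u \<le> v"
    then show "f u \<le> f v"
      unfolding f_def using \<delta> by (intro sum_mono mult_left_mono) (auto simp: indicator_def)
  qed
  have f_meas: "f \<in> borel_measurable borel" using f_mono by (rule borel_measurable_mono)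
  define U where "U t \<omega> = X t \<omega> - euler_limit f (\<lambda>s. X s \<omega>) t" for t \<omega>
  \<comment> \<open>The drift condition is given under bounded variation, which these analytic
    conditions imply.\<close>
  have K_less: "K < levy_drift \<gamma> \<nu>" if "\<sigma> = 0" "set_integrable \<nu> {0<..<1} (\<lambda>z. z)"
    using assms(6) bounded_variation_paths_if_small_jumps_summable[OF that] by (simp add: K_def)
  obtain q h where q: "q < 1" and h: "\<And>n. 0 < h n" "h \<longlonglongrightarrow> 0"
    and slope: "\<And>n. prob {\<omega> \<in> space M. X (h n) \<omega> - X 0 \<omega> \<le> K * h n} \<le> q"
    by (rule increments_exceed_slope[OF K_less]) (assumption | rule that)+
  have "AE \<omega> in M. \<forall>i\<in>{1..k}. AE s in lborel. 0 \<le> s \<longrightarrow> U s \<omega> \<noteq> b i"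
    unfolding U_def
    by (intro AE_finite_allI ballI AE_euler_solution_avoids_level[OF f f_mono h q slope]) simp
  with cadlag_paths have "AE \<omega> in M. \<forall>t\<ge>0.
      (\<forall>i\<in>{1..k}. set_integrable lborel {0..t} (\<lambda>s. indicator {b i<..} (U s \<omega>) :: real)) \<and>
      U t \<omega> = X t \<omega> - (\<Sum>i=1..k. \<delta> i * (LINT s:{0..t}|lborel. indicator {b i<..} (U s \<omega>)))"
  proof eventually_elim
    case (elim \<omega>)
    note X = elim(1)
    show ?case
    proof (intro allI impI conjI ballI)
      fix t :: real assume t: "0 \<le> t"
      show int: "set_integrable lborel {0..t} (\<lambda>s. indicator {b i<..} (U s \<omega>) :: real)" for i
        unfolding U_def
        by (intro set_integrable_bounded_Icc[where B=1] set_borel_measurable_solution[OF X f f_mono])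
           (auto simp: indicator_def)
      \<comment> \<open>Almost every time avoids all of the finitely many levels, so
        \<open>f\<close> is continuous at \<open>U s \<omega>\<close> and the limit equation
        applies.\<close>
      have "AE s in lborel. \<forall>i\<in>{1..k}. 0 \<le> s \<longrightarrow> U s \<omega> \<noteq> b i"
        using elim(2) by (intro AE_finite_allI) auto
      then have "AE s in lborel. s \<in> {0..t} \<longrightarrow> isCont f (U s \<omega>)"
        by eventually_elim (auto intro!: f_cont)
      then have "euler_limit f (\<lambda>s. X s \<omega>) t = (LINT s:{0..t}|lborel. f (U s \<omega>))"
        unfolding U_def by (rule euler_limit_integral_equation[OF X f f_mono t])
      \<comment> \<open>Linearity turns the integral of \<open>f\<close> into the weighted sum of
        occupation times required by \<open>strong_solution\<close>.\<close>
      also have "\<dots> = (LINT s|lborel. (\<Sum>i=1..k. \<delta> i * (indicator {0..t} s *\<^sub>R indicator {b i<..} (U s \<omega>))))"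
        unfolding set_lebesgue_integral_def f_def
        by (intro Bochner_Integration.integral_cong refl) (simp add: sum_distrib_left mult.left_commute del: sum_mult_indicator)
      also have "\<dots> = (\<Sum>i=1..k. LINT s|lborel. \<delta> i * (indicator {0..t} s *\<^sub>R indicator {b i<..} (U s \<omega>)))"
        by (intro Bochner_Integration.integral_sum integrable_mult_right) (use int in \<open>simp add: set_integrable_def\<close>)
      also have "\<dots> = (\<Sum>i=1..k. \<delta> i * (LINT s:{0..t}|lborel. indicator {b i<..} (U s \<omega>)))"
        unfolding set_lebesgue_integral_def by (intro sum.cong refl integral_mult_right_zero)
      finally show "U t \<omega> = X t \<omega> - (\<Sum>i=1..k. \<delta> i * (LINT s:{0..t}|lborel. indicator {b i<..} (U s \<omega>)))"
        by (simp add: U_def)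
    qed
  qed
  moreover have "U t \<in> borel_measurable (natural_filtration M X t)" if "0 \<le> t" for t
    unfolding U_def using that
    by (intro borel_measurable_diff natural_filtration_measurable euler_limit_adapted f_meas) auto
  ultimately show ?thesis
    unfolding strong_solution_def by blast
qed

end
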